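(* Let $F=(f_1,\ldots,f_n):\mathbb D\to\mathbb D^n$ be harmonic with $F(0)=p=(p_1,\ldots,p_n)$. Then $$\|dF_0\|\le M_{\mathbb D^n}(p):=\left(\sum_{j=1}^n\mathcal M(|p_j|)^2\right)^{1/2},$$ and the constant is sharp for every $p\in\mathbb D^n$, that is, the supremum of $\|dF_0\|$ over harmonic $F:\mathbb D\to\mathbb D^n$ with $F(0)=p$ equals $M_{\mathbb D^n}(p)$. Equality $\|dF_0\|=M_{\mathbb D^n}(p)$ holds if and only if every component $f_j$ is extremal in the disk-valued problem at $p_j$ and all differentials $d(f_j)_0$ attain their norms on a common unit vector in $\mathbb R^2$.
   Context: $\mathbb D=\{z\in\mathbb C:|z|<1\}$. Harmonic maps into $\mathbb C^n\simeq\mathbb R^{2n}$ are understood componentwise (complex-valued harmonic components). $\|dF_0\|$ is the operator norm of the real differential $dF_0:\mathbb R^2\to\mathbb R^{2n}$ for the Euclidean norms, and likewise for $d(f_j)_0:\mathbb R^2\to\mathbb R^2$. The function $\mathcal M:[0,1)\to(0,\infty)$ is given by $\mathcal M(0)=4/\pi$ and, for $0<r<1$, $$\mathcal M(r)=2\int_0^{2\pi}\frac{\cos^2t}{\sqrt{\lambda(r)^2+\cos^2t}}\,\frac{dt}{2\pi},$$ where $\lambda(r)>0$ is the unique positive solution of $$r=\int_0^{2\pi}\frac{\lambda(r)}{\sqrt{\lambda(r)^2+\cos^2t}}\,\frac{dt}{2\pi}.$$ A harmonic $f:\mathbb D\to\mathbb D$ with $f(0)=w$ is extremal in the disk-valued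 problem at $w$ if $\|df_0\|$ equals the supremum of $\|dg_0\|$ over all harmonic $g:\mathbb D\to\mathbb D$ with $g(0)=w$; this supremum is $\mathcal M(|w|)$. *)

theory Defs
  imports "HOL-Analysis.Analysis"
begin

(* All derivatives are real Frechet derivatives, with complex regarded as the Euclidean
   plane R^2 with orthonormal basis 1, i.  The condition below says that f is C^2 on S
   (first and second derivatives Df, D2f, the latter continuous) with f_xx + f_yy = 0. *)
definition harmonic_on :: "(complex \<Rightarrow> complex) \<Rightarrow> complex set \<Rightarrow> bool" where
  "harmonic_on f S \<longleftrightarrow>
     open S \<and>
     (\<exists>(Df :: complex \<Rightarrow> complex \<Rightarrow>\<^sub>L complex)
        (D2f :: complex \<Rightarrow> complex \<Rightarrow>\<^sub>L complex \<Rightarrow>\<^sub>L complex).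
        (\<forall>z\<in>S. (f has_derivative blinfun_apply (Df z)) (at z)) \<and>
        (\<forall>z\<in>S. (Df has_derivative blinfun_apply (D2f z)) (at z)) \<and>
        continuous_on S D2f \<and>
        (\<forall>z\<in>S. blinfun_apply (blinfun_apply (D2f z) 1) 1 +
                blinfun_apply (blinfun_apply (D2f z) \<i>) \<i> = 0))"

abbreviation unit_disk :: "complex set" where
  "unit_disk \<equiv> ball 0 1"

(* Maps are total functions on complex; only their values on the unit disk matter. *)
definition harmonic_disk_maps :: "complex \<Rightarrow> (complex \<Rightarrow> complex) set" where
  "harmonic_disk_maps w =
     {f. harmonic_on f unit_disk \<and> (\<forall>z\<in>unit_disk. f z \<in> unit_disk) \<and> f 0 = w}"

definition unit_polydisk :: "(complex ^ 'n::finite) set" where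
  "unit_polydisk = {p. \<forall>j. p $ j \<in> unit_disk}"

definition harmonic_polydisk_maps ::
  "complex ^ 'n::finite \<Rightarrow> (complex \<Rightarrow> complex ^ 'n) set" where
  "harmonic_polydisk_maps p =
     {F. (\<forall>j. harmonic_on (\<lambda>z. F z $ j) unit_disk) \<and>
         (\<forall>z\<in>unit_disk. F z \<in> unit_polydisk) \<and> F 0 = p}"

definition diff0 :: "(complex \<Rightarrow> 'b::real_normed_vector) \<Rightarrow> complex \<Rightarrow> 'b" where
  "diff0 F = frechet_derivative F (at 0)"

(* The defining equation has a unique positive solution for 0 < r < 1; the value at
   other r is irrelevant. *)
definition lambda :: "real \<Rightarrow> real" where
  "lambda r = (THE l. l > 0 \<and>
     r = integral {0..2 * pi} (\<lambda>t. l / sqrt (l\<^sup>2 + (cos t)\<^sup>2) / (2 * pi)))"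

definition calM :: "real \<Rightarrow> real" where
  "calM r = (if r = 0 then 4 / pi
     else 2 * integral {0..2 * pi}
            (\<lambda>t. (cos t)\<^sup>2 / sqrt ((lambda r)\<^sup>2 + (cos t)\<^sup>2) / (2 * pi)))"

definition M_polydisk :: "complex ^ 'n::finite \<Rightarrow> real" where
  "M_polydisk p = sqrt (\<Sum>j\<in>UNIV. (calM (norm (p $ j)))\<^sup>2)"

definition extremal_at :: "complex \<Rightarrow> (complex \<Rightarrow> complex) \<Rightarrow> bool" where
  "extremal_at w f \<longleftrightarrow>
     f \<in> harmonic_disk_maps w \<and>
     onorm (diff0 f) = (SUP g\<in>harmonic_disk_maps w. onorm (diff0 g))"

end

(* A harmonic f on the disk is H + cnj K with H, K holomorphic, so on the circle of radius
   r < 1 it satisfies f(0) = avg f and r df_0(v) = avg 2 f(r e^{it} v) cos t. Let u be the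
   unit direction of df_0(v), e the one of w = f(0), and l > 0. Since |f| <= 1,

     avg <f, 2 cos t u + 2 l e>  <=  2 avg |cos t u + l e|  <=  2 avg sqrt (l^2 + cos^2 t),

   that is, |df_0(v)| <= 2 avg sqrt (l^2 + cos^2 t) - 2 l |w|; for l = lambda |w| the right-hand
   side is M(|w|), and for w = 0 one lets l tend to 0. Equality throughout means u orthogonal to e and
   boundary values e (l + i cos t) / sqrt (l^2 + cos^2 t), whose Poisson extension is indeed
   extremal; for w = 0 it degenerates to (4/pi) Re Arctan. All these extremals attain their norm
   in the direction 1, so combining them componentwise is extremal for the polydisk, where
   |dF_0(v)|^2 is the sum of the |d(f_j)_0(v)|^2. *)
theory Submission
  imports Defs "HOL-Complex_Analysis.Cauchy_Integral_Formula"
begin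

text \<open>Why \<open>lambda\<close>: the dual bound
  \<open>sqrt_integral l / pi - 2 * l * norm w\<close> is convex in \<open>l\<close> with derivative
  \<open>2 * (lambda_mean l - norm w)\<close>. The equation defining \<open>lambda\<close> is thus
  stationarity, and the bound is smallest there. For \<open>w = 0\<close> the stationary point moves
  to the excluded value 0, so the constant 4/pi, which is \<open>sqrt_integral 0 / pi\<close>, is
  reached only as a limit. The disk bound is the same for every direction \<open>v\<close>. This
  decides the polydisk: one \<open>v\<close> can saturate all components, and a sum of squares
  bounded term by term is maximal only if each term is. The equality clause then rests on the value
  of the disk supremum and on a unit vector where the norm of the differential is attained. Two
  obstacles shape the rest. \<open>harmonic_on\<close> speaks of second Frechet derivatives, so
  their symmetry has to come before the Cauchy-Riemann equations. And an extremal map must land in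
  the open disk, although its boundary values have modulus 1, so a strict inequality has to be
  proved for the Poisson extension.\<close>

subsection \<open>Harmonic functions as sums of holomorphic and antiholomorphic ones\<close>

text \<open>Mean value inequality for \<open>\<psi>\<close>, the increment of \<open>f\<close> in
  direction \<open>u\<close> followed along the segment in direction \<open>v\<close>, with its
  expected linear growth removed. The mixed difference is symmetric in \<open>u\<close> and
  \<open>v\<close>, whereas the approximating term \<open>D2 u v\<close> is not visibly so.\<close>

lemma second_difference_bound:
  fixes f :: "'a::real_normed_vector \<Rightarrow> 'b::real_normed_vector"
    and Df :: "'a \<Rightarrow> 'a \<Rightarrow>\<^sub>L 'b"
  assumes S: "\<And>x. x \<in> ball z d \<Longrightarrow> (f has_derivative blinfun_apply (Df x)) (at x)"
    and e: "\<And>x. x \<in> ball z d \<Longrightarrow> norm (Df x - Df z - D2 (x - z)) \<le> e * norm (x - z)"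
    and D2: "bounded_linear D2"
    and t: "0 < t" "t * (norm u + norm v) < d" and e0: "0 \<le> e"
  shows "norm (f (z + t *\<^sub>R u + t *\<^sub>R v) - f (z + t *\<^sub>R u) - f (z + t *\<^sub>R v) + f z
           - t\<^sup>2 *\<^sub>R blinfun_apply (D2 u) v) \<le> 2 * e * t\<^sup>2 * (norm u + norm v)\<^sup>2"
proof -
  interpret D2: bounded_linear D2 by (fact D2)
  define \<psi> where "\<psi> = (\<lambda>s. f (z + t *\<^sub>R u + s *\<^sub>R (t *\<^sub>R v)) - f (z + s *\<^sub>R (t *\<^sub>R v))
      - s *\<^sub>R (t\<^sup>2 *\<^sub>R blinfun_apply (D2 u) v))"
  define \<psi>' where "\<psi>' = (\<lambda>s. blinfun_apply (Df (z + t *\<^sub>R u + s *\<^sub>R (t *\<^sub>R v))) (t *\<^sub>R v)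
      - blinfun_apply (Df (z + s *\<^sub>R (t *\<^sub>R v))) (t *\<^sub>R v) - t\<^sup>2 *\<^sub>R blinfun_apply (D2 u) v)"
  have n1: "norm (t *\<^sub>R u + s *\<^sub>R (t *\<^sub>R v)) \<le> t * (norm u + norm v)"
    and n2: "norm (s *\<^sub>R (t *\<^sub>R v)) \<le> t * (norm u + norm v)" if "s \<in> {0..1}" for s
  proof -
    have "s * (t * norm v) \<le> t * norm v"
      using that t by (simp add: mult_left_le_one_le)
    then show "norm (s *\<^sub>R (t *\<^sub>R v)) \<le> t * (norm u + norm v)"
    proof -
      have "norm (s *\<^sub>R (t *\<^sub>R v)) = s * (t * norm v)" using that t by simp
      moreover have "0 \<le> t * norm u" using t by simp
      ultimately show ?thesis using \<open>s * (t * norm v) \<le> t * norm v\<close> by (simp only: distrib_left)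
    qed
    show "norm (t *\<^sub>R u + s *\<^sub>R (t *\<^sub>R v)) \<le> t * (norm u + norm v)"
      using that t \<open>s * (t * norm v) \<le> t * norm v\<close>
      by (intro order_trans[OF norm_triangle_ineq]) (simp add: algebra_simps)
  qed
  have mem: "z + x \<in> ball z d" if "norm x < d" for x
    using that by (simp add: dist_norm)
  have m1: "z + t *\<^sub>R u + s *\<^sub>R (t *\<^sub>R v) \<in> ball z d" and m2: "z + s *\<^sub>R (t *\<^sub>R v) \<in> ball z d"
    if "s \<in> {0..1}" for s
    using order.strict_trans1[OF n1[OF that] t(2)] order.strict_trans1[OF n2[OF that] t(2)]
    by (simp_all only: add.assoc mem)
  have der: "(\<psi> has_derivative (\<lambda>h. h *\<^sub>R \<psi>' s)) (at s within {0..1})" if "s \<in> {0..1}" for s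
  proof -
    have 1: "((\<lambda>s. f (z + t *\<^sub>R u + s *\<^sub>R (t *\<^sub>R v))) has_derivative
        (\<lambda>h. blinfun_apply (Df (z + t *\<^sub>R u + s *\<^sub>R (t *\<^sub>R v))) (h *\<^sub>R (t *\<^sub>R v)))) (at s within {0..1})"
      by (rule has_derivative_compose[where g = f and f = "\<lambda>s. z + t *\<^sub>R u + s *\<^sub>R (t *\<^sub>R v)", OF _ S[OF m1[OF that]]]) (auto intro!: derivative_eq_intros)
    have 2: "((\<lambda>s. f (z + s *\<^sub>R (t *\<^sub>R v))) has_derivative
        (\<lambda>h. blinfun_apply (Df (z + s *\<^sub>R (t *\<^sub>R v))) (h *\<^sub>R (t *\<^sub>R v)))) (at s within {0..1})"
      by (rule has_derivative_compose[where g = f and f = "\<lambda>s. z + s *\<^sub>R (t *\<^sub>R v)", OF _ S[OF m2[OF that]]]) (auto intro!: derivative_eq_intros)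
    show ?thesis
      unfolding \<psi>_def \<psi>'_def
      by (rule has_derivative_eq_rhs, rule has_derivative_diff[OF has_derivative_diff[OF 1 2]
            has_derivative_scaleR_left[OF has_derivative_ident]])
         (simp add: fun_eq_iff blinfun.scaleR_right scaleR_diff_right)
  qed
  have bd: "norm (\<psi>' s) \<le> 2 * e * t\<^sup>2 * (norm u + norm v)\<^sup>2" if s: "s \<in> {0..1}" for s
  proof -
    define a where "a = t *\<^sub>R u + s *\<^sub>R (t *\<^sub>R v)"
    define b where "b = s *\<^sub>R (t *\<^sub>R v)"
    \<comment> \<open>Remainder of \<open>Df\<close> at its linearisation in \<open>z\<close>. In
      \<open>\<psi>'\<close> the values at \<open>z\<close> and the linear terms cancel against the
      subtracted constant, leaving two remainders that are both small.\<close>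
    define R where "R = (\<lambda>x. Df (z + x) - Df z - D2 x)"
    have ab: "D2 a = t *\<^sub>R D2 u + D2 b"
      by (simp add: a_def b_def D2.add D2.scaleR)
    have "\<psi>' s = blinfun_apply (R a - R b) (t *\<^sub>R v)"
      unfolding \<psi>'_def R_def ab
      by (simp add: a_def b_def blinfun.bilinear_simps algebra_simps power2_eq_square)
    also have "norm \<dots> \<le> norm (R a - R b) * norm (t *\<^sub>R v)"
      by (rule norm_blinfun)
    also have "\<dots> \<le> (e * norm a + e * norm b) * norm (t *\<^sub>R v)"
      using e[OF m1[OF s]] e[OF m2[OF s]]
      by (intro mult_right_mono order_trans[OF norm_triangle_ineq4] add_mono)
         (simp_all add: R_def a_def b_def algebra_simps)
    also have "\<dots> \<le> (e * (t * (norm u + norm v)) + e * (t * (norm u + norm v))) * (t * (norm u + norm v))"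
      using n1[OF s] n2[OF s] e0 t
      by (intro mult_mono add_mono mult_left_mono) (auto simp: a_def b_def)
    also have "\<dots> = 2 * e * t\<^sup>2 * (norm u + norm v)\<^sup>2"
      by (simp add: power2_eq_square algebra_simps)
    finally show ?thesis .
  qed
  have "norm (\<psi> 1 - \<psi> 0) \<le> 2 * e * t\<^sup>2 * (norm u + norm v)\<^sup>2 * norm (1 - 0::real)"
  proof (rule differentiable_bound[of "{0..1}" \<psi> "\<lambda>s h. h *\<^sub>R \<psi>' s"])
    show "onorm (\<lambda>h. h *\<^sub>R \<psi>' s) \<le> 2 * e * t\<^sup>2 * (norm u + norm v)\<^sup>2" if "s \<in> {0..1}" for s
    proof (rule onorm_bound)
      show "norm (h *\<^sub>R \<psi>' s) \<le> 2 * e * t\<^sup>2 * (norm u + norm v)\<^sup>2 * norm h" for h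
        using mult_left_mono[OF bd[OF that] norm_ge_zero[of h]] by (simp add: mult_ac)
    qed (use e0 in simp)
  qed (use der in auto)
  then show ?thesis by (simp add: \<psi>_def algebra_simps)
qed

text \<open>Both orders of \<open>u\<close> and \<open>v\<close> approximate the same mixed
  difference up to a small multiple of \<open>t\<^sup>2\<close>; dividing by
  \<open>t\<^sup>2\<close> leaves an arbitrarily small bound for their difference.\<close>

lemma second_derivative_symmetric:
  fixes f :: "'a::real_normed_vector \<Rightarrow> 'b::real_normed_vector"
    and Df :: "'a \<Rightarrow> 'a \<Rightarrow>\<^sub>L 'b" and D2 :: "'a \<Rightarrow>\<^sub>L 'a \<Rightarrow>\<^sub>L 'b"
  assumes S: "open S" "z \<in> S"
    and Df: "\<And>x. x \<in> S \<Longrightarrow> (f has_derivative blinfun_apply (Df x)) (at x)"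
    and D2: "(Df has_derivative blinfun_apply D2) (at z)"
  shows "blinfun_apply (blinfun_apply D2 u) v = blinfun_apply (blinfun_apply D2 v) u"
proof -
  \<comment> \<open>Twice the constant of the preceding estimate; the added 1 keeps the divisor
    positive when \<open>u\<close> and \<open>v\<close> vanish. The same device appears in the
    choice of \<open>t\<close>.\<close>
  define C where "C = 4 * (norm u + norm v)\<^sup>2 + 1"
  have C: "C > 0" by (simp add: C_def add_nonneg_pos)
  have "norm (blinfun_apply (blinfun_apply D2 u) v - blinfun_apply (blinfun_apply D2 v) u) \<le> 0 + \<epsilon>"
    if "\<epsilon> > 0" for \<epsilon>
  proof -
    define e where "e = \<epsilon> / C"
    have e: "e > 0" using that C by (simp add: e_def)
    obtain d1 where d1: "d1 > 0" "ball z d1 \<subseteq> S" using S openE by blast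
    obtain d2 where d2: "d2 > 0"
      "\<And>x. norm (x - z) < d2 \<Longrightarrow> norm (Df x - Df z - blinfun_apply D2 (x - z)) \<le> e * norm (x - z)"
      using D2 e unfolding has_derivative_at_alt by blast
    define d where "d = min d1 d2"
    define t where "t = d / (norm u + norm v + 1) / 2"
    have dpos: "d > 0" using d1 d2 by (simp add: d_def)
    have nn: "norm u + norm v + 1 > 0" by (simp add: add_nonneg_pos)
    have t: "t > 0" using dpos nn by (simp add: t_def)
    have "t * (norm u + norm v) \<le> t * (norm u + norm v + 1)" using t by simp
    also have "\<dots> = d / 2" using nn unfolding t_def by (metis nonzero_divide_eq_eq less_irrefl times_divide_eq_left)
    also have "\<dots> < d" using dpos by simp
    finally have t2: "t * (norm u + norm v) < d" .
    have A: "x \<in> ball z d \<Longrightarrow> (f has_derivative blinfun_apply (Df x)) (at x)" for x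
      using Df d1 by (auto simp: d_def)
    have B: "x \<in> ball z d \<Longrightarrow> norm (Df x - Df z - blinfun_apply D2 (x - z)) \<le> e * norm (x - z)" for x
      using d2 by (auto simp: d_def dist_norm norm_minus_commute)
    define \<Delta> where "\<Delta> = f (z + t *\<^sub>R u + t *\<^sub>R v) - f (z + t *\<^sub>R u) - f (z + t *\<^sub>R v) + f z"
    define P where "P = blinfun_apply (blinfun_apply D2 u) v"
    define Q where "Q = blinfun_apply (blinfun_apply D2 v) u"
    have "norm (\<Delta> - t\<^sup>2 *\<^sub>R P) \<le> 2 * e * t\<^sup>2 * (norm u + norm v)\<^sup>2"
      using second_difference_bound[OF A B blinfun.bounded_linear_right t t2] e
      by (simp add: \<Delta>_def P_def)
    moreover have "norm (\<Delta> - t\<^sup>2 *\<^sub>R Q) \<le> 2 * e * t\<^sup>2 * (norm u + norm v)\<^sup>2"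
      using second_difference_bound[OF A B blinfun.bounded_linear_right t, where u = v and v = u] t2 e
      by (simp add: \<Delta>_def Q_def algebra_simps)
    ultimately have "norm ((\<Delta> - t\<^sup>2 *\<^sub>R Q) - (\<Delta> - t\<^sup>2 *\<^sub>R P)) \<le> t\<^sup>2 * (e * (4 * (norm u + norm v)\<^sup>2))"
      by (intro order_trans[OF norm_triangle_ineq4]) (simp add: algebra_simps)
    moreover have "(\<Delta> - t\<^sup>2 *\<^sub>R Q) - (\<Delta> - t\<^sup>2 *\<^sub>R P) = t\<^sup>2 *\<^sub>R (P - Q)"
      by (simp add: algebra_simps)
    ultimately have "t\<^sup>2 * norm (P - Q) \<le> t\<^sup>2 * (e * (4 * (norm u + norm v)\<^sup>2))"
      by simp
    then have "norm (P - Q) \<le> e * (4 * (norm u + norm v)\<^sup>2)"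
      using t by simp
    also have "\<dots> \<le> e * C" using e by (simp add: C_def)
    also have "\<dots> = \<epsilon>" using C by (simp add: e_def)
    finally show ?thesis by (simp add: P_def Q_def)
  qed
  then have "norm (blinfun_apply (blinfun_apply D2 u) v - blinfun_apply (blinfun_apply D2 v) u) \<le> 0"
    by (rule field_le_epsilon)
  then show ?thesis by simp
qed

text \<open>The Wirtinger derivative of \<open>f\<close> with respect to z is holomorphic because
  \<open>f\<close> is harmonic. Convexity supplies a primitive \<open>H\<close>, and
  \<open>f - H\<close> has vanishing z-derivative, hence is antiholomorphic.\<close>

lemma harmonic_on_decompose:
  assumes "harmonic_on f S" "convex S"
  obtains H K where "H holomorphic_on S" "K holomorphic_on S" "\<And>z. z \<in> S \<Longrightarrow> f z = H z + cnj (K z)"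
proof -
  obtain Df :: "complex \<Rightarrow> complex \<Rightarrow>\<^sub>L complex" and D2f :: "complex \<Rightarrow> complex \<Rightarrow>\<^sub>L complex \<Rightarrow>\<^sub>L complex"
    where S: "open S"
    and Df: "\<And>z. z \<in> S \<Longrightarrow> (f has_derivative blinfun_apply (Df z)) (at z)"
    and D2f: "\<And>z. z \<in> S \<Longrightarrow> (Df has_derivative blinfun_apply (D2f z)) (at z)"
    and lap: "\<And>z. z \<in> S \<Longrightarrow> blinfun_apply (blinfun_apply (D2f z) 1) 1 +
                blinfun_apply (blinfun_apply (D2f z) \<i>) \<i> = 0"
    using assms(1) unfolding harmonic_on_def by (elim conjE exE) (rule that, auto)
  have real_lin: "L h = of_real (Re h) * L 1 + of_real (Im h) * L \<i>"
    if "bounded_linear L" for L :: "complex \<Rightarrow> complex" and h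
  proof -
    interpret L: bounded_linear L by fact
    have "L h = L (Re h *\<^sub>R 1 + Im h *\<^sub>R \<i>)"
      by (rule arg_cong[of _ _ L]) (simp add: complex_eq_iff)
    then show ?thesis by (simp only: L.add L.scaleR) (simp only: scaleR_conv_of_real)
  qed
  \<comment> \<open>The Wirtinger derivative (f_x - i f_y)/2.\<close>
  define g where "g = (\<lambda>z. (blinfun_apply (Df z) 1 - \<i> * blinfun_apply (Df z) \<i>) / 2)"
  have "(g has_field_derivative (blinfun_apply (blinfun_apply (D2f z) 1) 1
          - \<i> * blinfun_apply (blinfun_apply (D2f z) 1) \<i>) / 2) (at z)" if z: "z \<in> S" for z
  proof -
    let ?D = "\<lambda>h. (blinfun_apply (blinfun_apply (D2f z) h) 1 - \<i> * blinfun_apply (blinfun_apply (D2f z) h) \<i>) / 2"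
    have D: "(g has_derivative ?D) (at z)"
      unfolding g_def by (rule bounded_linear.has_derivative[OF _ D2f[OF z]])
        (intro bounded_linear_compose[OF bounded_linear_divide] bounded_linear_sub
          bounded_linear_compose[OF bounded_linear_mult_right] blinfun.bounded_linear_left)
    have "?D h = ?D 1 * h" for h
    proof -
      have sym: "blinfun_apply (blinfun_apply (D2f z) \<i>) 1 = blinfun_apply (blinfun_apply (D2f z) 1) \<i>"
        by (rule second_derivative_symmetric[OF S z Df D2f[OF z]])
      have "bounded_linear ?D"
        using D by (rule has_derivative_bounded_linear)
      from real_lin[OF this, of h]
      have "?D h = of_real (Re h) * ?D 1 + of_real (Im h) * ?D \<i>" .
      \<comment> \<open>The Cauchy-Riemann equation for \<open>g\<close>: the Laplace equation
        handles the pure second derivatives, symmetry the mixed ones.\<close>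
      also have "?D \<i> = \<i> * ?D 1"
      proof -
        have "blinfun_apply (blinfun_apply (D2f z) 1) 1 = - blinfun_apply (blinfun_apply (D2f z) \<i>) \<i>"
          using lap[OF z] by (simp add: eq_neg_iff_add_eq_0)
        then show ?thesis using sym by (simp add: algebra_simps)
      qed
      also have "of_real (Re h) * ?D 1 + of_real (Im h) * (\<i> * ?D 1) = ?D 1 * h"
      proof -
        have "of_real (Re h) * X + of_real (Im h) * (\<i> * X) = X * h" for X
          by (simp add: complex_eq_iff algebra_simps)
        then show ?thesis .
      qed
      finally show ?thesis .
    qed
    then show ?thesis
      unfolding has_field_derivative_def by - (rule has_derivative_eq_rhs[OF D], rule ext)
  qed
  then have hol: "g holomorphic_on S"
    using S by (auto simp: holomorphic_on_open)
  obtain H where H: "\<And>z. z \<in> S \<Longrightarrow> (H has_field_derivative g z) (at z within S)"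
    by (rule holomorphic_convex_primitive'[OF assms(2) S hol]) (rule that, assumption)
  define K where "K = (\<lambda>z. cnj (f z - H z))"
  \<comment> \<open>Conjugate of the other Wirtinger derivative (f_x + i f_y)/2, the only one that
    survives in \<open>f - H\<close>.\<close>
  define q where "q = (\<lambda>z. cnj (blinfun_apply (Df z) 1 + \<i> * blinfun_apply (Df z) \<i>) / 2)"
  have "(K has_field_derivative q z) (at z)" if z: "z \<in> S" for z
  proof -
    have "(H has_derivative (*) (g z)) (at z)"
      using H[OF z] by (simp add: has_field_derivative_def at_within_open[OF z S])
    then have D: "(K has_derivative (\<lambda>h. cnj (blinfun_apply (Df z) h - g z * h))) (at z)"
      unfolding K_def by (intro derivative_intros Df z)
    have "cnj (blinfun_apply (Df z) h - g z * h) = q z * h" for h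
    proof -
      have "blinfun_apply (Df z) h = of_real (Re h) * blinfun_apply (Df z) 1 + of_real (Im h) * blinfun_apply (Df z) \<i>"
        by (rule real_lin) (rule blinfun.bounded_linear_right)
      moreover have "cnj (of_real (Re h) * a + of_real (Im h) * b - (a - \<i> * b) / 2 * h)
          = cnj (a + \<i> * b) / 2 * h" for a b
        by (simp add: complex_eq_iff) (simp add: field_simps)
      ultimately show ?thesis
        by (simp only: q_def g_def)
    qed
    then show ?thesis
      unfolding has_field_derivative_def by - (rule has_derivative_eq_rhs[OF D], rule ext)
  qed
  then have "K holomorphic_on S" using S by (auto simp: holomorphic_on_open)
  moreover have "H holomorphic_on S" using H unfolding holomorphic_on_def field_differentiable_def by blast
  moreover have "f z = H z + cnj (K z)" for z by (simp add: K_def)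
  ultimately show ?thesis using that by blast
qed

subsection \<open>Circle means\<close>

lemma has_contour_integral_circlepath_cis:
  fixes h :: "complex \<Rightarrow> complex"
  assumes "(h has_contour_integral I) (circlepath 0 r)"
  shows "((\<lambda>t. h (r * cis t) * r * \<i> * cis t) has_integral I) {0..2*pi}"
  using assms has_contour_integral_part_circlepath_iff[of 0 "2*pi" h I 0 r]
  by (simp add: circlepath_def)

text \<open>The weight \<open>cos t\<close> is half the sum of \<open>cis t\<close> and its inverse.
  The inverse yields Cauchy's formula for the first derivative, while \<open>cis t\<close> yields
  the integral of \<open>H\<close> itself, which vanishes by Cauchy's theorem.\<close>

lemma holomorphic_circle_means:
  fixes H :: "complex \<Rightarrow> complex" and r :: real
  assumes "H holomorphic_on ball 0 1" "0 < r" "r < 1"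
  shows "((\<lambda>t. H (r * cis t)) has_integral 2 * pi * H 0) {0..2*pi}"
    and "((\<lambda>t. H (r * cis t) * cos t) has_integral pi * r * deriv H 0) {0..2*pi}"
proof -
  have sub: "cball (0::complex) r \<subseteq> ball 0 1" using assms by auto
  have c: "continuous_on (cball 0 r) H"
    using holomorphic_on_imp_continuous_on[OF assms(1)] sub by (rule continuous_on_subset)
  have h: "H holomorphic_on ball 0 r" by (rule holomorphic_on_subset[OF assms(1)]) (use assms in auto)
  have "((\<lambda>u. H u / (u - 0)) has_contour_integral 2 * of_real pi * \<i> * H 0) (circlepath 0 r)"
    by (rule Cauchy_integral_circlepath) (use c h assms in auto)
  from has_integral_mult_right[OF has_contour_integral_circlepath_cis[OF this], of "-\<i>"]
  show "((\<lambda>t. H (r * cis t)) has_integral 2 * pi * H 0) {0..2*pi}"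
    using assms by (simp add: field_simps)
  have 1: "((\<lambda>u. H u / (u - 0) ^ Suc 1) has_contour_integral (2 * pi * \<i>) / fact 1 * (deriv ^^ 1) H 0) (circlepath 0 r)"
    by (rule Cauchy_has_contour_integral_higher_derivative_circlepath) (use c h assms in auto)
  have 2: "(H has_contour_integral 0) (circlepath 0 r)"
    by (rule Cauchy_theorem_convex_simple[OF assms(1)])
       (use assms in \<open>auto simp: path_image_circlepath_minus\<close>)
  \<comment> \<open>The factors undo the line element \<open>r * \<i> * cis t\<close> and the powers
    of \<open>r\<close>, so that the integrands become \<open>H\<close> times half of
    \<open>inverse (cis t)\<close> and half of \<open>cis t\<close>.\<close>
  note 3 = has_integral_mult_right[OF has_contour_integral_circlepath_cis[OF 1], of "-\<i> * r / 2"]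
  note 4 = has_integral_mult_right[OF has_contour_integral_circlepath_cis[OF 2], of "-\<i> / (2 * r)"]
  have "((\<lambda>t. H (r * cis t) * cos t) has_integral (-\<i> * r / 2) * ((2 * pi * \<i>) / fact 1 * (deriv ^^ 1) H 0) + (-\<i> / (2 * r)) * 0) {0..2*pi}"
  proof (rule has_integral_eq[OF _ has_integral_add[OF 3 4]])
    fix t :: real
    have e: "of_real (cos t) = (cis t + inverse (cis t)) / 2"
      by (simp add: complex_eq_iff)
    show "- \<i> * of_real r / 2 * (H (r * cis t) / (r * cis t - 0) ^ Suc 1 * r * \<i> * cis t) +
         - \<i> / (2 * r) * (H (r * cis t) * r * \<i> * cis t) = H (r * cis t) * cos t"
      unfolding e using assms by (simp add: field_simps)
  qed
  then show "((\<lambda>t. H (r * cis t) * cos t) has_integral pi * r * deriv H 0) {0..2*pi}"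
    by (simp add: algebra_simps)
qed

lemma harmonic_differentiable_at:
  assumes "harmonic_on f S" "z \<in> S"
  shows "f differentiable (at z)"
  using assms unfolding harmonic_on_def differentiable_def by blast

lemma diff0_has_derivative: "F differentiable (at 0) \<Longrightarrow> (F has_derivative diff0 F) (at 0)"
  by (simp add: diff0_def frechet_derivative_works)

text \<open>Rotating the variable by \<open>v\<close> turns the derivative in direction
  \<open>v\<close> into one in direction 1. The weight \<open>cos t\<close> is real, so the
  antiholomorphic part follows by conjugation.\<close>

lemma harmonic_circle_means:
  fixes f :: "complex \<Rightarrow> complex"
  fixes r :: real
  assumes "harmonic_on f unit_disk" "0 < r" "r < 1" "norm v = 1"
  shows "((\<lambda>t. f (r * cis t * v)) has_integral 2 * pi * f 0) {0..2*pi}"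
    and "((\<lambda>t. f (r * cis t * v) * cos t) has_integral pi * r * diff0 f v) {0..2*pi}"
proof -
  obtain H K where H: "H holomorphic_on ball 0 1" and K: "K holomorphic_on ball 0 1"
    and f: "\<And>z. z \<in> ball 0 1 \<Longrightarrow> f z = H z + cnj (K z)"
    using harmonic_on_decompose[OF assms(1) convex_ball] by metis
  have mv: "(\<lambda>z. z * v) ` ball 0 1 \<subseteq> ball 0 1"
    using assms(4) by (auto simp: norm_mult)
  have hol: "(\<lambda>z. G (z * v)) holomorphic_on ball 0 1" if "G holomorphic_on ball 0 1" for G
  proof -
    have "(\<lambda>z. z * v) holomorphic_on ball 0 1" by (intro holomorphic_intros)
    from holomorphic_on_compose_gen[OF this that mv] show ?thesis by (simp add: o_def)
  qed
  have der: "deriv (\<lambda>z. G (z * v)) 0 = v * deriv G 0" if "G holomorphic_on ball 0 1" for G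
  proof -
    have "(G has_field_derivative deriv G 0) (at (0 * v))"
      using holomorphic_derivI[OF that, of 0] by simp
    then have "((\<lambda>z. G (z * v)) has_field_derivative deriv G 0 * v) (at 0)"
      by (rule DERIV_chain2) (auto intro!: derivative_eq_intros)
    then show ?thesis by (simp add: DERIV_imp_deriv mult.commute)
  qed
  have in_disk: "r * cis t * v \<in> ball 0 1" for t
    using assms by (simp add: norm_mult)
  have fe: "f (r * cis t * v) = H (r * cis t * v) + cnj (K (r * cis t * v))" for t
    by (rule f[OF in_disk])
  have f0: "f 0 = H 0 + cnj (K 0)"
    by (rule f) simp
  note I = has_integral_add[OF holomorphic_circle_means(1)[OF hol[OF H] assms(2,3)]
      has_integral_cnj[THEN iffD2, OF holomorphic_circle_means(1)[OF hol[OF K] assms(2,3)]]]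
  note J = has_integral_add[OF holomorphic_circle_means(2)[OF hol[OF H] assms(2,3)]
      has_integral_cnj[THEN iffD2, OF holomorphic_circle_means(2)[OF hol[OF K] assms(2,3)]]]
  show "((\<lambda>t. f (r * cis t * v)) has_integral 2 * pi * f 0) {0..2*pi}"
    unfolding fe f0 using I by (simp add: algebra_simps)
  have "(H has_derivative (*) (deriv H 0)) (at 0)" "(K has_derivative (*) (deriv K 0)) (at 0)"
    using holomorphic_derivI[OF H, of 0] holomorphic_derivI[OF K, of 0]
    by (simp_all add: has_field_derivative_def)
  then have "((\<lambda>z. H z + cnj (K z)) has_derivative (\<lambda>h. deriv H 0 * h + cnj (deriv K 0 * h))) (at 0)"
    by (intro derivative_intros)
  then have "(f has_derivative (\<lambda>h. deriv H 0 * h + cnj (deriv K 0 * h))) (at 0)"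
    by (rule has_derivative_transform_within_open[of _ _ _ _ "ball 0 1"]) (use f in auto)
  then have "diff0 f v = deriv H 0 * v + cnj (deriv K 0 * v)"
    unfolding diff0_def by (metis frechet_derivative_at)
  then show "((\<lambda>t. f (r * cis t * v) * cos t) has_integral pi * r * diff0 f v) {0..2*pi}"
    unfolding fe using J der[OF H] der[OF K] by (simp add: algebra_simps)
qed

subsection \<open>The functions lambda and M\<close>

definition lambda_mean :: "real \<Rightarrow> real" where
  "lambda_mean l = integral {0..2 * pi} (\<lambda>t. l / sqrt (l\<^sup>2 + (cos t)\<^sup>2) / (2 * pi))"

lemma sq_add_cos_pos: "0 < l \<Longrightarrow> 0 < l\<^sup>2 + (cos t)\<^sup>2" for l t :: real
  by (simp add: add_pos_nonneg)

lemma continuous_on_lambda_integrand: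
  "0 < l \<Longrightarrow> continuous_on A (\<lambda>t. l / sqrt (l\<^sup>2 + (cos t)\<^sup>2) / (2 * pi))" for l :: real
  using sq_add_cos_pos[of l] by (intro continuous_intros) (auto simp: less_imp_neq[symmetric])

lemma continuous_on_lambda_mean: "continuous_on {0<..} lambda_mean"
  unfolding lambda_mean_def cbox_interval[symmetric]
proof (rule integral_continuous_on_param)
  show "continuous_on ({0<..} \<times> cbox 0 (2 * pi)) (\<lambda>(l, t). l / sqrt (l\<^sup>2 + (cos t)\<^sup>2) / (2 * pi))"
    unfolding split_beta
    using sq_add_cos_pos by (intro continuous_intros) (auto simp: less_imp_neq[symmetric])
qed

lemma lambda_integrand_mono:
  fixes a b c :: real
  assumes "0 < a" "a \<le> b"
  shows "a / sqrt (a\<^sup>2 + c\<^sup>2) \<le> b / sqrt (b\<^sup>2 + c\<^sup>2)"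
proof -
  have "a * sqrt (b\<^sup>2 + c\<^sup>2) \<le> b * sqrt (a\<^sup>2 + c\<^sup>2)"
  proof (rule power2_le_imp_le)
    have "a\<^sup>2 * c\<^sup>2 \<le> b\<^sup>2 * c\<^sup>2" using assms by (intro mult_right_mono power_mono) auto
    then show "(a * sqrt (b\<^sup>2 + c\<^sup>2))\<^sup>2 \<le> (b * sqrt (a\<^sup>2 + c\<^sup>2))\<^sup>2"
      by (simp add: power_mult_distrib algebra_simps)
  qed (use assms in auto)
  moreover have "0 < a\<^sup>2 + c\<^sup>2" "0 < b\<^sup>2 + c\<^sup>2" using assms by (simp_all add: add_pos_nonneg)
  ultimately show ?thesis by (simp add: divide_simps)
qed

text \<open>The integrands are ordered pointwise and continuous, so equal integrals would make them
  agree everywhere on the interval; at \<open>t = 0\<close> they differ.\<close>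

lemma lambda_mean_less:
  assumes "0 < a" "a < b"
  shows "lambda_mean a < lambda_mean b"
proof -
  let ?f = "\<lambda>l t. l / sqrt (l\<^sup>2 + (cos t)\<^sup>2) / (2 * pi)"
  have c: "continuous_on {0..2*pi} (?f a)" "continuous_on {0..2*pi} (?f b)"
    using assms by (intro continuous_on_lambda_integrand; simp)+
  have le: "?f a t \<le> ?f b t" for t
    using assms by (intro divide_right_mono lambda_integrand_mono) auto
  have diff: "integral {0..2*pi} (\<lambda>t. ?f b t - ?f a t) = lambda_mean b - lambda_mean a"
    unfolding lambda_mean_def using c by (intro integral_diff integrable_continuous_interval)
  moreover have "integral {0..2*pi} (\<lambda>t. ?f b t - ?f a t) \<noteq> 0"
  proof
    assume "integral {0..2*pi} (\<lambda>t. ?f b t - ?f a t) = 0"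
    then have "\<forall>t\<in>{0..2*pi}. ?f b t - ?f a t = 0"
      by (subst (asm) integral_eq_0_iff) (use c le in \<open>auto intro!: continuous_on_diff\<close>)
    then have "?f b 0 - ?f a 0 = 0" by (rule bspec) simp
    then have "b / sqrt (b\<^sup>2 + 1) / (2 * pi) = a / sqrt (a\<^sup>2 + 1) / (2 * pi)" by simp
    then have "2 * pi = 0 \<or> b / sqrt (b\<^sup>2 + 1) = a / sqrt (a\<^sup>2 + 1)" by (simp only: divide_cancel_right)
    then have "b / sqrt (b\<^sup>2 + 1) = a / sqrt (a\<^sup>2 + 1)" by simp
    then have "(b / sqrt (b\<^sup>2 + 1))\<^sup>2 = (a / sqrt (a\<^sup>2 + 1))\<^sup>2" by simp
    then have "b\<^sup>2 / (b\<^sup>2 + 1) = a\<^sup>2 / (a\<^sup>2 + 1)"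
      by (simp add: power_divide)
    moreover have "b\<^sup>2 + 1 \<noteq> 0" "a\<^sup>2 + 1 \<noteq> 0" by (smt (verit) zero_le_power2)+
    ultimately have "b\<^sup>2 = a\<^sup>2" by (simp add: field_simps)
    then show False using assms by (simp add: power2_eq_iff_nonneg)
  qed
  moreover have "integral {0..2*pi} (\<lambda>t. ?f b t - ?f a t) \<ge> 0"
    using c le by (intro integral_nonneg integrable_continuous_interval continuous_on_diff) auto
  ultimately show ?thesis by linarith
qed

text \<open>The lower bound tends to 1 as \<open>l\<close> grows, so \<open>lambda_mean\<close>
  exceeds every number below 1.\<close>

lemma lambda_mean_ge:
  assumes "0 < l"
  shows "l / sqrt (l\<^sup>2 + 1) \<le> lambda_mean l"
proof -
  have "integral {0..2*pi} (\<lambda>t. l / sqrt (l\<^sup>2 + 1) / (2 * pi)) \<le> lambda_mean l"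
    unfolding lambda_mean_def
  proof (rule integral_le)
    fix t :: real
    have "(cos t)\<^sup>2 \<le> 1" using sin_cos_squared_add2[of t] zero_le_power2[of "sin t"] by linarith
    then show "l / sqrt (l\<^sup>2 + 1) / (2 * pi) \<le> l / sqrt (l\<^sup>2 + (cos t)\<^sup>2) / (2 * pi)"
      using assms sq_add_cos_pos[of l t]
      by (intro divide_right_mono divide_left_mono real_sqrt_le_mono mult_pos_pos) (auto simp: add_pos_nonneg)
  qed (use continuous_on_lambda_integrand[OF assms] in \<open>auto intro: integrable_continuous_interval\<close>)
  then show ?thesis by simp
qed

text \<open>Dominated convergence with the integrand's own bound \<open>1 / (2 * pi)\<close>.
  Together with \<open>lambda_mean_ge\<close> it shows that all values in (0,1) are passed.\<close>

lemma lambda_mean_small: "(\<lambda>k. lambda_mean (inverse (real (Suc k)))) \<longlonglongrightarrow> 0"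
proof -
  \<comment> \<open>The exact pointwise limit: at zeros of the cosine the integrand equals
    \<open>1 / (2 * pi)\<close> for every \<open>l > 0\<close>. These zeros are countable, hence
    negligible.\<close>
  define g where "g = (\<lambda>t::real. if cos t = 0 then 1 / (2 * pi) else 0)"
  let ?e = "\<lambda>k. inverse (real (Suc k))"
  have "(\<lambda>k. integral {0..2 * pi} (\<lambda>t. ?e k / sqrt ((?e k)\<^sup>2 + (cos t)\<^sup>2) / (2 * pi))) \<longlonglongrightarrow> integral {0..2 * pi} g"
  proof (rule dominated_convergence(2))
    show "(\<lambda>t. ?e k / sqrt ((?e k)\<^sup>2 + (cos t)\<^sup>2) / (2 * pi)) integrable_on {0..2 * pi}" for k
      by (intro integrable_continuous_interval continuous_on_lambda_integrand) simp
    show "(\<lambda>t. 1 / (2 * pi)) integrable_on {0..2 * pi}"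
      by (rule integrable_const_ivl)
    show "norm (?e k / sqrt ((?e k)\<^sup>2 + (cos t)\<^sup>2) / (2 * pi)) \<le> 1 / (2 * pi)" for k t
    proof -
      have "sqrt ((?e k)\<^sup>2) \<le> sqrt ((?e k)\<^sup>2 + (cos t)\<^sup>2)" by (rule real_sqrt_le_mono) simp
      then have "?e k \<le> sqrt ((?e k)\<^sup>2 + (cos t)\<^sup>2)" by simp
      then have "?e k / sqrt ((?e k)\<^sup>2 + (cos t)\<^sup>2) \<le> 1"
        using sq_add_cos_pos[of "?e k" t] by (simp add: divide_le_eq_1)
      then have "?e k / sqrt ((?e k)\<^sup>2 + (cos t)\<^sup>2) / (2 * pi) \<le> 1 / (2 * pi)"
        by (intro divide_right_mono) auto
      then show ?thesis by simp
    qed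
    show "(\<lambda>k. ?e k / sqrt ((?e k)\<^sup>2 + (cos t)\<^sup>2) / (2 * pi)) \<longlonglongrightarrow> g t" for t
    proof (cases "cos t = 0")
      case True
      have "e / sqrt (e\<^sup>2 + (cos t)\<^sup>2) / (2 * pi) = 1 / (2 * pi)" if "0 < e" for e :: real
        using True that by simp
      then show ?thesis using True by (simp add: g_def del: of_nat_Suc)
    next
      case False
      have "(\<lambda>k. ?e k / sqrt ((?e k)\<^sup>2 + (cos t)\<^sup>2) / (2 * pi)) \<longlonglongrightarrow> 0 / sqrt (0\<^sup>2 + (cos t)\<^sup>2) / (2 * pi)"
        using False by (intro tendsto_intros LIMSEQ_inverse_real_of_nat) auto
      then show ?thesis using False by (simp add: g_def)
    qed
  qed
  moreover have "(g has_integral 0) {0..2*pi}"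
  proof (rule has_integral_spike[OF _ _ has_integral_0])
    have "{t::real. cos t = 0} \<subseteq> (\<Union>i::int. {of_int i * (pi/2)})"
      using cos_zero_iff_int by blast
    moreover have "negligible (\<Union>i::int. {of_int i * (pi/2)})"
      by (rule negligible_countable_Union) auto
    ultimately show "negligible {t::real. cos t = 0}"
      by (metis negligible_subset)
  qed (auto simp: g_def)
  ultimately show ?thesis by (simp add: lambda_mean_def integral_unique)
qed

text \<open>Existence by the intermediate value theorem, uniqueness by strict monotonicity; only
  with both does the description operator in \<open>lambda\<close> return a solution.\<close>

lemma lambda_props:
  assumes "0 < r" "r < 1"
  shows "0 < lambda r" "lambda_mean (lambda r) = r"
proof -
  obtain a where a: "0 < a" "lambda_mean a < r"
  proof -
    have "\<forall>\<^sub>F k in sequentially. lambda_mean (inverse (real (Suc k))) < r"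
      using order_tendstoD(2)[OF lambda_mean_small assms(1)] .
    then obtain k where "lambda_mean (inverse (real (Suc k))) < r"
      by (auto simp: eventually_sequentially)
    then show ?thesis using that[of "inverse (real (Suc k))"] by simp
  qed
  obtain b where b: "0 < b" "r < lambda_mean b"
  proof -
    \<comment> \<open>Midpoint of \<open>r\<close> and 1; \<open>b\<close> is then obtained by
      solving \<open>b / sqrt (b\<^sup>2 + 1) = s\<close>.\<close>
    define s where "s = (r + 1) / 2"
    have s: "r < s" "s < 1" "0 < s" using assms by (auto simp: s_def)
    have s2: "0 < 1 - s\<^sup>2" using s by (simp add: abs_square_less_1)
    define b where "b = s / sqrt (1 - s\<^sup>2)"
    have "b\<^sup>2 + 1 = 1 / (1 - s\<^sup>2)"
      using s2 by (simp add: b_def power_divide field_simps)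
    then have "b / sqrt (b\<^sup>2 + 1) = s"
      using s2 by (simp add: b_def real_sqrt_divide)
    moreover have "0 < b" using s s2 by (simp add: b_def)
    ultimately show ?thesis using that[of b] lambda_mean_ge[of b] s by simp
  qed
  have "a < b"
    using lambda_mean_less[of b a] a b by (cases a b rule: linorder_cases) auto
  moreover have cont: "continuous_on {a..b} lambda_mean"
    by (rule continuous_on_subset[OF continuous_on_lambda_mean]) (use a in auto)
  ultimately obtain l where l: "a \<le> l" "lambda_mean l = r"
    using IVT'[of lambda_mean a r b] a b cont by auto
  have "l > 0" using l a by simp
  have ex: "\<exists>!l. l > 0 \<and> r = lambda_mean l"
  proof (rule ex1I[of _ l])
    fix m assume m: "m > 0 \<and> r = lambda_mean m"
    then show "m = l"
      using lambda_mean_less[of m l] lambda_mean_less[of l m] l \<open>l > 0\<close> by (cases m l rule: linorder_cases) auto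
  qed (use l \<open>l > 0\<close> in simp)
  have "lambda r = (THE l. l > 0 \<and> r = lambda_mean l)"
    by (simp add: lambda_def lambda_mean_def)
  with theI'[OF ex] show "0 < lambda r" "lambda_mean (lambda r) = r" by auto
qed

text \<open>The antiderivative is \<open>arcsin (sin t / sqrt (1 + l\<^sup>2))\<close>. Its argument
  stays strictly inside (-1,1), so it is smooth across the whole period.\<close>

lemma integral_cos_div_sqrt:
  assumes "0 < l"
  shows "((\<lambda>t. cos t / sqrt (l\<^sup>2 + (cos t)\<^sup>2)) has_integral 0) {0..2*pi}"
proof -
  let ?k = "sqrt (1 + l\<^sup>2)"
  have k: "?k > 1" "?k\<^sup>2 = 1 + l\<^sup>2" using assms by auto
  have "((\<lambda>t. cos t / sqrt (l\<^sup>2 + (cos t)\<^sup>2)) has_integral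
     arcsin (sin (2*pi) / ?k) - arcsin (sin 0 / ?k)) {0..2*pi}"
  proof (rule fundamental_theorem_of_calculus)
    fix t :: real
    have "0 < ?k" using k by linarith
    then have b: "-1 < sin t / ?k" "sin t / ?k < 1"
      using k(1) abs_sin_le_one[of t] by (auto simp only: pos_less_divide_eq pos_divide_less_eq)
    have "1 - (sin t / ?k)\<^sup>2 = (l\<^sup>2 + (cos t)\<^sup>2) / ?k\<^sup>2"
    proof -
      have "1 + l\<^sup>2 \<noteq> 0" using k(2) \<open>0 < ?k\<close> by auto
      then have "1 - (1 - (cos t)\<^sup>2) / (1 + l\<^sup>2) = (l\<^sup>2 + (cos t)\<^sup>2) / (1 + l\<^sup>2)"
        by (simp add: diff_divide_distrib[symmetric] divide_simps)
      then show ?thesis unfolding power_divide k(2) sin_squared_eq .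
    qed
    then have "sqrt (1 - (sin t / ?k)\<^sup>2) = sqrt (l\<^sup>2 + (cos t)\<^sup>2) / ?k"
      by (simp only: real_sqrt_divide real_sqrt_abs) (use k in simp)
    moreover have "((\<lambda>t. arcsin (sin t / ?k)) has_real_derivative
        inverse (sqrt (1 - (sin t / ?k)\<^sup>2)) * (cos t / ?k)) (at t within {0..2*pi})"
      by (rule DERIV_chain2[where f = arcsin and g = "\<lambda>t. sin t / ?k", OF DERIV_arcsin[OF b]])
        (rule DERIV_cdivide, auto intro!: derivative_eq_intros)
    moreover have "?k \<noteq> 0" using k by linarith
    ultimately show "((\<lambda>t. arcsin (sin t / ?k)) has_vector_derivative
        cos t / sqrt (l\<^sup>2 + (cos t)\<^sup>2)) (at t within {0..2*pi})"
      by (simp add: has_real_derivative_iff_has_vector_derivative)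
  qed simp
  then show ?thesis by simp
qed

lemma integral_abs_cos: "((\<lambda>t. \<bar>cos t\<bar>) has_integral 4) {0..2*pi}"
proof -
  have cos_int: "(cos has_integral sin b - sin a) {a..b}" if "a \<le> b" for a b :: real
    using that by (intro fundamental_theorem_of_calculus)
      (auto intro!: derivative_eq_intros simp flip: has_real_derivative_iff_has_vector_derivative)
  have 1: "((\<lambda>t. \<bar>cos t\<bar>) has_integral sin (pi/2) - sin 0) {0..pi/2}"
    by (rule has_integral_eq[OF _ cos_int]) (auto intro!: cos_ge_zero abs_of_nonneg[symmetric])
  have 2: "((\<lambda>t. \<bar>cos t\<bar>) has_integral - (sin (3*pi/2) - sin (pi/2))) {pi/2..3*pi/2}"
  proof (rule has_integral_eq[OF _ has_integral_neg[OF cos_int]])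
    fix t assume "t \<in> {pi/2..3*pi/2}"
    then have "0 \<le> cos (t - pi)" by (intro cos_ge_zero) auto
    then show "- cos t = \<bar>cos t\<bar>" by simp
  qed simp
  have 3: "((\<lambda>t. \<bar>cos t\<bar>) has_integral sin (2*pi) - sin (3*pi/2)) {3*pi/2..2*pi}"
  proof (rule has_integral_eq[OF _ cos_int])
    fix t assume "t \<in> {3*pi/2..2*pi}"
    then have "0 \<le> cos (t - 2*pi)" by (intro cos_ge_zero) auto
    then show "cos t = \<bar>cos t\<bar>" by (simp add: cos_diff)
  qed simp
  have s: "sin (3*pi/2) = -1"
    using sin_3over2_pi by simp
  have "((\<lambda>t. \<bar>cos t\<bar>) has_integral (1 + 2) + 1) {0..2*pi}"
    using has_integral_combine[OF _ _ has_integral_combine[OF _ _ 1 2] 3] by (simp add: s)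
  then show ?thesis by simp
qed

definition sqrt_integral :: "real \<Rightarrow> real" where
  "sqrt_integral l = integral {0..2*pi} (\<lambda>t. sqrt (l\<^sup>2 + (cos t)\<^sup>2))"

lemma sqrt_integral: "((\<lambda>t. sqrt (l\<^sup>2 + (cos t)\<^sup>2)) has_integral sqrt_integral l) {0..2*pi}"
  unfolding sqrt_integral_def
  by (intro integrable_integral integrable_continuous_interval continuous_intros)

text \<open>Subadditivity of the square root; 4 is the integral of \<open>\<bar>cos t\<bar>\<close>.
  This controls the limit \<open>l\<close> to 0 that serves the centre \<open>w = 0\<close>.\<close>

lemma sqrt_integral_le:
  assumes "0 \<le> l"
  shows "sqrt_integral l \<le> 4 + 2 * pi * l"
proof (rule has_integral_le[OF sqrt_integral])
  show "((\<lambda>t. \<bar>cos t\<bar> + l) has_integral 4 + 2 * pi * l) {0..2*pi}"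
    using has_integral_add[OF integral_abs_cos has_integral_const_real[of l 0 "2*pi"]] by simp
  show "sqrt (l\<^sup>2 + (cos t)\<^sup>2) \<le> \<bar>cos t\<bar> + l" for t
    using sqrt_add_le_add_sqrt[of "l\<^sup>2" "(cos t)\<^sup>2"] assms by simp
qed

lemma calM_nonneg: "0 \<le> calM r"
proof (cases "r = 0")
  case False
  \<comment> \<open>No condition on \<open>r\<close> is available, so \<open>lambda r\<close> may be
    unspecified; a non-integrable integrand would give the default integral 0.\<close>
  have "0 \<le> integral {0..2 * pi} (\<lambda>t. (cos t)\<^sup>2 / sqrt ((lambda r)\<^sup>2 + (cos t)\<^sup>2) / (2 * pi))"
    by (cases "(\<lambda>t. (cos t)\<^sup>2 / sqrt ((lambda r)\<^sup>2 + (cos t)\<^sup>2) / (2 * pi)) integrable_on {0..2 * pi}")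
       (auto intro!: integral_nonneg simp: not_integrable_integral)
  then show ?thesis using False by (simp add: calM_def)
qed (simp add: calM_def)

lemma calM_has_integral:
  assumes "0 < r" "r < 1"
  shows "((\<lambda>t. (cos t)\<^sup>2 / sqrt ((lambda r)\<^sup>2 + (cos t)\<^sup>2)) has_integral pi * calM r) {0..2*pi}"
proof -
  note l = lambda_props[OF assms]
  let ?f = "\<lambda>t. (cos t)\<^sup>2 / sqrt ((lambda r)\<^sup>2 + (cos t)\<^sup>2) / (2 * pi)"
  have "continuous_on {0..2*pi} ?f"
    using sq_add_cos_pos[OF l(1)] by (intro continuous_intros) (auto simp: less_imp_neq[symmetric])
  then have "(?f has_integral integral {0..2*pi} ?f) {0..2*pi}"
    by (intro integrable_integral integrable_continuous_interval)
  from has_integral_mult_right[OF this, of "2 * pi"] show ?thesis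
    using assms by (simp add: calM_def mult_ac)
qed

lemma lambda_has_integral:
  assumes "0 < r" "r < 1"
  shows "((\<lambda>t. lambda r / sqrt ((lambda r)\<^sup>2 + (cos t)\<^sup>2)) has_integral 2 * pi * r) {0..2*pi}"
proof -
  note l = lambda_props[OF assms]
  let ?f = "\<lambda>t. lambda r / sqrt ((lambda r)\<^sup>2 + (cos t)\<^sup>2) / (2 * pi)"
  have "(?f has_integral r) {0..2*pi}"
    using integrable_integral[OF integrable_continuous_interval[OF continuous_on_lambda_integrand[OF l(1)]]] l(2)
    unfolding lambda_mean_def by metis
  from has_integral_mult_right[OF this, of "2 * pi"] show ?thesis by (simp add: mult_ac)
qed

text \<open>Writing s for the root, \<open>cos\<^sup>2/s + l * (l/s) = s\<close> holds pointwise;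
  integrating it, the second term is evaluated by the defining equation of
  \<open>lambda\<close>.\<close>

lemma calM_eq_sqrt_integral:
  assumes "0 < r" "r < 1"
  shows "calM r = sqrt_integral (lambda r) / pi - 2 * lambda r * r"
proof -
  note l = lambda_props[OF assms]
  have "((\<lambda>t. sqrt ((lambda r)\<^sup>2 + (cos t)\<^sup>2)) has_integral pi * calM r + lambda r * (2 * pi * r)) {0..2*pi}"
  proof (rule has_integral_eq[OF _ has_integral_add[OF calM_has_integral[OF assms]
          has_integral_mult_right[OF lambda_has_integral[OF assms], of "lambda r"]]])
    fix t
    have "0 < (lambda r)\<^sup>2 + (cos t)\<^sup>2" by (rule sq_add_cos_pos[OF l(1)])
    then show "(cos t)\<^sup>2 / sqrt ((lambda r)\<^sup>2 + (cos t)\<^sup>2) + lambda r * (lambda r / sqrt ((lambda r)\<^sup>2 + (cos t)\<^sup>2))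
        = sqrt ((lambda r)\<^sup>2 + (cos t)\<^sup>2)"
      by (simp add: real_div_sqrt add.commute power2_eq_square flip: add_divide_distrib)
  qed
  from has_integral_unique[OF this sqrt_integral] show ?thesis
    by (simp add: field_simps)
qed

subsection \<open>The upper bound in the disk\<close>

text \<open>Concavity: the graph lies below its tangent at \<open>X\<close>. After squaring, the
  defect is the square of \<open>Y / (2 * sqrt X)\<close>.\<close>

lemma sqrt_tangent:
  fixes X Y :: real
  assumes "0 < X" "0 \<le> X + Y"
  shows "sqrt (X + Y) \<le> sqrt X + Y / (2 * sqrt X)"
proof (rule real_le_lsqrt)
  have s: "sqrt X > 0" "(sqrt X)\<^sup>2 = X" using assms by auto
  have "sqrt X + Y / (2 * sqrt X) = (X + (X + Y)) / (2 * sqrt X)"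
    using s by (simp add: field_simps power2_eq_square)
  also have "\<dots> \<ge> 0" using assms by (intro divide_nonneg_nonneg) auto
  finally show "0 \<le> sqrt X + Y / (2 * sqrt X)" .
  have "(sqrt X + Y / (2 * sqrt X))\<^sup>2 = X + Y + (Y / (2 * sqrt X))\<^sup>2"
    using s by (simp add: power2_sum) 
  then show "X + Y \<le> (sqrt X + Y / (2 * sqrt X))\<^sup>2" by simp
qed

text \<open>For \<open>d = 0\<close> any unit vector will do; this keeps a vanishing derivative or
  centre from becoming a separate case in the dual estimate.\<close>

lemma unit_vector_of: obtains e :: complex where "norm e = 1" "d = norm d *\<^sub>R e"
proof (cases "d = 0")
  case True
  then show ?thesis using that[of 1] by simp
next
  case False
  then show ?thesis using that[of "sgn d"] by (simp add: norm_sgn sgn_div_norm)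
qed

text \<open>Weak duality: \<open>l e\<close> is the Lagrange multiplier of the constraint \<open>f 0 = w\<close>.
  It depends only on \<open>w\<close>, not on the direction \<open>u\<close> of the derivative, because the cross term
  \<open>cos t (u \<bullet> e)\<close> integrates to zero after linearising the square root.\<close>

lemma harmonic_disk_derivative_bound:
  assumes f: "f \<in> harmonic_disk_maps w" and v: "norm v = 1" and l: "0 < l"
  shows "norm (diff0 f v) \<le> sqrt_integral l / pi - 2 * l * norm w"
proof -
  define d where "d = diff0 f v"
  have h: "harmonic_on f unit_disk" and fb: "\<And>z. z \<in> unit_disk \<Longrightarrow> norm (f z) < 1" and f0: "f 0 = w"
    using f by (auto simp: harmonic_disk_maps_def)
  obtain u where u: "norm u = 1" "d = norm d *\<^sub>R u" by (rule unit_vector_of)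
  obtain e where e: "norm e = 1" "w = norm w *\<^sub>R e" by (rule unit_vector_of)
  have du: "d \<bullet> u = norm d"
    using u by (metis inner_scaleR_left norm_eq_1 mult.right_neutral)
  have we: "w \<bullet> e = norm w"
    using e by (metis inner_scaleR_left norm_eq_1 mult.right_neutral)
  \<comment> \<open>Radii below 1 are used because \<open>f\<close> carries no boundary values; the
    factor \<open>\<rho>\<close> disappears in the limit at 1.\<close>
  have bound: "2 * pi * \<rho> * norm d + 4 * pi * l * norm w \<le> 2 * sqrt_integral l" if \<rho>: "0 < \<rho>" "\<rho> < 1" for \<rho>
  proof -
    let ?g = "\<lambda>t. f (\<rho> * cis t * v)"
    let ?s = "\<lambda>t. sqrt (l\<^sup>2 + (cos t)\<^sup>2)"
    note m = harmonic_circle_means[OF h \<rho> v]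
    have 1: "((\<lambda>t. 2 * ((?g t * cos t) \<bullet> u)) has_integral 2 * ((pi * \<rho> * d) \<bullet> u)) {0..2*pi}"
      using has_integral_linear[OF m(2) bounded_linear_inner_left] unfolding o_def d_def
      by (rule has_integral_mult_right)
    have 2: "((\<lambda>t. 2 * l * (?g t \<bullet> e)) has_integral 2 * l * ((2 * pi * f 0) \<bullet> e)) {0..2*pi}"
      using has_integral_linear[OF m(1) bounded_linear_inner_left] unfolding o_def
      by (rule has_integral_mult_right)
    have 3: "((\<lambda>t. 2 * ?s t + 2 * l * (u \<bullet> e) * (cos t / ?s t)) has_integral
        2 * sqrt_integral l + 2 * l * (u \<bullet> e) * 0) {0..2*pi}"
      by (intro has_integral_add has_integral_mult_right sqrt_integral integral_cos_div_sqrt l)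
    have "2 * ((pi * \<rho> * d) \<bullet> u) + 2 * l * ((2 * pi * f 0) \<bullet> e) \<le> 2 * sqrt_integral l + 2 * l * (u \<bullet> e) * 0"
    proof (rule has_integral_le[OF has_integral_add[OF 1 2] 3])
      fix t :: real
      let ?c = "cos t" and ?X = "l\<^sup>2 + (cos t)\<^sup>2"
      have X: "?X > 0" by (rule sq_add_cos_pos[OF l])
      have "(norm (?c *\<^sub>R u + l *\<^sub>R e))\<^sup>2 = ?X + 2 * l * ?c * (u \<bullet> e)"
        using u(1) e(1) unfolding power2_norm_eq_inner
        by (simp add: inner_add_left inner_add_right inner_commute norm_eq_1 power2_eq_square algebra_simps)
      then have n: "norm (?c *\<^sub>R u + l *\<^sub>R e) = sqrt (?X + 2 * l * ?c * (u \<bullet> e))" "0 \<le> ?X + 2 * l * ?c * (u \<bullet> e)"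
        by (metis norm_ge_zero real_sqrt_unique, metis zero_le_power2)
      have "\<rho> * cis t * v \<in> unit_disk" using \<rho> v by (simp add: norm_mult)
      then have "norm (?g t) \<le> 1" using fb by (simp add: less_imp_le)
      then have "?g t \<bullet> (?c *\<^sub>R u + l *\<^sub>R e) \<le> 1 * norm (?c *\<^sub>R u + l *\<^sub>R e)"
        by (intro order_trans[OF norm_cauchy_schwarz] mult_right_mono) auto
      also have "\<dots> \<le> ?s t + 2 * l * ?c * (u \<bullet> e) / (2 * ?s t)"
        unfolding n(1) mult_1 by (rule sqrt_tangent[OF X n(2)])
      finally have q: "?g t \<bullet> (?c *\<^sub>R u + l *\<^sub>R e) \<le> ?s t + 2 * l * ?c * (u \<bullet> e) / (2 * ?s t)" .
      have "(?g t * ?c) \<bullet> u = ?c * (?g t \<bullet> u)"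
        by (simp add: inner_complex_def algebra_simps)
      with mult_left_mono[OF q, of 2] show "2 * ((?g t * ?c) \<bullet> u) + 2 * l * (?g t \<bullet> e) \<le> 2 * ?s t + 2 * l * (u \<bullet> e) * (?c / ?s t)"
        by (simp add: inner_add_right algebra_simps)
    qed
    moreover have "(pi * \<rho> * d) \<bullet> u = pi * \<rho> * norm d"
      unfolding du[symmetric] by (simp add: inner_complex_def algebra_simps)
    moreover have "(2 * pi * f 0) \<bullet> e = 2 * pi * norm w"
      unfolding f0 we[symmetric] by (simp add: inner_complex_def algebra_simps)
    ultimately show ?thesis by (simp add: algebra_simps)
  qed
  have "2 * pi * 1 * norm d + 4 * pi * l * norm w \<le> 2 * sqrt_integral l"
  proof (rule tendsto_upperbound)
    show "((\<lambda>\<rho>. 2 * pi * \<rho> * norm d + 4 * pi * l * norm w) \<longlongrightarrow> 2 * pi * 1 * norm d + 4 * pi * l * norm w) (at_left 1)"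
      by (intro tendsto_intros)
    show "\<forall>\<^sub>F \<rho> in at_left 1. 2 * pi * \<rho> * norm d + 4 * pi * l * norm w \<le> 2 * sqrt_integral l"
      by (rule eventually_mono[OF eventually_at_left_real[of 0 1]]) (auto intro: bound)
  qed simp
  then have "norm d \<le> sqrt_integral l / pi - 2 * l * norm w"
    by (simp add: field_simps)
  then show ?thesis by (simp add: d_def)
qed

lemma harmonic_disk_derivative_le_calM:
  assumes f: "f \<in> harmonic_disk_maps w" and v: "norm v = 1" and w: "norm w < 1"
  shows "norm (diff0 f v) \<le> calM (norm w)"
proof (cases "w = 0")
  case False
  then have w': "0 < norm w" by simp
  show ?thesis
    unfolding calM_eq_sqrt_integral[OF w' w]
    by (rule harmonic_disk_derivative_bound[OF f v lambda_props(1)[OF w' w]])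
next
  case True
  have "norm (diff0 f v) \<le> 4 / pi + \<epsilon>" if "0 < \<epsilon>" for \<epsilon>
  proof -
    \<comment> \<open>With \<open>l = \<epsilon> / 2\<close> the excess
      \<open>2 * pi * l / pi\<close> over 4/pi is exactly \<open>\<epsilon>\<close>.\<close>
    have "norm (diff0 f v) \<le> sqrt_integral (\<epsilon> / 2) / pi"
      using harmonic_disk_derivative_bound[OF f v, of "\<epsilon> / 2"] that True by simp
    also have "\<dots> \<le> (4 + 2 * pi * (\<epsilon> / 2)) / pi"
      using that by (intro divide_right_mono sqrt_integral_le) auto
    also have "\<dots> = 4 / pi + \<epsilon>" by (simp add: add_divide_distrib)
    finally show ?thesis .
  qed
  then have "norm (diff0 f v) \<le> 4 / pi" by (rule field_le_epsilon)
  then show ?thesis by (simp add: True calM_def)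
qed

subsection \<open>Extremal maps of the disk\<close>

lemma harmonic_on_add:
  assumes "harmonic_on f S" "harmonic_on g S"
  shows "harmonic_on (\<lambda>z. f z + g z) S"
proof -
  from assms(1) obtain Df :: "complex \<Rightarrow> complex \<Rightarrow>\<^sub>L complex" and D2f :: "complex \<Rightarrow> complex \<Rightarrow>\<^sub>L complex \<Rightarrow>\<^sub>L complex"
    where f: "open S" "\<forall>z\<in>S. (f has_derivative blinfun_apply (Df z)) (at z)"
      "\<forall>z\<in>S. (Df has_derivative blinfun_apply (D2f z)) (at z)" "continuous_on S D2f"
      "\<forall>z\<in>S. blinfun_apply (blinfun_apply (D2f z) 1) 1 + blinfun_apply (blinfun_apply (D2f z) \<i>) \<i> = 0"
    unfolding harmonic_on_def by (elim conjE exE) (rule that)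
  from assms(2) obtain Dg :: "complex \<Rightarrow> complex \<Rightarrow>\<^sub>L complex" and D2g :: "complex \<Rightarrow> complex \<Rightarrow>\<^sub>L complex \<Rightarrow>\<^sub>L complex"
    where g: "\<forall>z\<in>S. (g has_derivative blinfun_apply (Dg z)) (at z)"
      "\<forall>z\<in>S. (Dg has_derivative blinfun_apply (D2g z)) (at z)" "continuous_on S D2g"
      "\<forall>z\<in>S. blinfun_apply (blinfun_apply (D2g z) 1) 1 + blinfun_apply (blinfun_apply (D2g z) \<i>) \<i> = 0"
    unfolding harmonic_on_def by (elim conjE exE) (rule that)
  show ?thesis
    unfolding harmonic_on_def
  proof (intro conjI exI[of _ "\<lambda>z. Df z + Dg z"] exI[of _ "\<lambda>z. D2f z + D2g z"] ballI)
    fix z assume z: "z \<in> S"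
    show "((\<lambda>z. f z + g z) has_derivative blinfun_apply (Df z + Dg z)) (at z)"
      unfolding plus_blinfun.rep_eq using f(2) g(1) z by (intro has_derivative_add) auto
    show "((\<lambda>z. Df z + Dg z) has_derivative blinfun_apply (D2f z + D2g z)) (at z)"
      unfolding plus_blinfun.rep_eq using f(3) g(2) z by (intro has_derivative_add) auto
    have "blinfun_apply (blinfun_apply (D2f z) 1) 1 + blinfun_apply (blinfun_apply (D2f z) \<i>) \<i>
        + (blinfun_apply (blinfun_apply (D2g z) 1) 1 + blinfun_apply (blinfun_apply (D2g z) \<i>) \<i>) = 0"
      using f(5) g(4) z by simp
    then show "blinfun_apply (blinfun_apply (D2f z + D2g z) 1) 1 + blinfun_apply (blinfun_apply (D2f z + D2g z) \<i>) \<i> = 0"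
      by (simp add: blinfun.add_left algebra_simps)
  qed (use f(1,4) g(3) in \<open>auto intro: continuous_on_add\<close>)
qed

text \<open>The second derivative in directions h, k is \<open>T\<close> applied to the product of
  \<open>H''\<close>, h and k, and the square of \<open>\<i>\<close> is -1, so the Laplacian
  cancels. \<open>T\<close> is merely real-linear, which admits multiples of the real part.\<close>

lemma harmonic_on_linear_holomorphic:
  fixes T :: "complex \<Rightarrow> complex"
  assumes T: "bounded_linear T" and H: "H holomorphic_on S" and S: "open S"
  shows "harmonic_on (\<lambda>z. T (H z)) S"
proof -
  define B where "B = Blinfun T"
  have B: "blinfun_apply B = T" unfolding B_def using T by (rule bounded_linear_Blinfun_apply)
  \<comment> \<open>\<open>P c\<close> is the map sending h to \<open>T (c * h)\<close>; composing
    \<open>P\<close> with \<open>deriv H\<close> gives the first derivative, and linearity of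
    \<open>P\<close> gives the second.\<close>
  define P :: "complex \<Rightarrow>\<^sub>L complex \<Rightarrow>\<^sub>L complex" where "P = Blinfun (\<lambda>c. B o\<^sub>L blinfun_mult_right c)"
  have P: "blinfun_apply P = (\<lambda>c. B o\<^sub>L blinfun_mult_right c)"
    unfolding P_def by (rule bounded_linear_Blinfun_apply)
      (rule bounded_linear_compose[OF bounded_bilinear.bounded_linear_right[OF bounded_bilinear_blinfun_compose]
        bounded_linear_blinfun_mult_right])
  have H': "deriv H holomorphic_on S" and H'': "deriv (deriv H) holomorphic_on S"
    using H S by (auto intro: holomorphic_deriv)
  have der: "(G has_derivative (*) (deriv G z)) (at z)" if "G holomorphic_on S" "z \<in> S" for G z
    using holomorphic_derivI[OF that(1) S that(2)] by (simp add: has_field_derivative_def)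
  show ?thesis
    unfolding harmonic_on_def
  proof (intro conjI exI[of _ "\<lambda>z. blinfun_apply P (deriv H z)"]
      exI[of _ "\<lambda>z. P o\<^sub>L blinfun_mult_right (deriv (deriv H) z)"] ballI)
    fix z assume z: "z \<in> S"
    show "((\<lambda>z. T (H z)) has_derivative blinfun_apply (blinfun_apply P (deriv H z))) (at z)"
      by (rule has_derivative_eq_rhs[OF bounded_linear.has_derivative[OF T der[OF H z]]])
         (simp add: fun_eq_iff P B)
    show "((\<lambda>z. blinfun_apply P (deriv H z)) has_derivative
        blinfun_apply (P o\<^sub>L blinfun_mult_right (deriv (deriv H) z))) (at z)"
      by (rule has_derivative_eq_rhs[OF bounded_linear.has_derivative[OF blinfun.bounded_linear_right der[OF H' z]]])
         (simp add: fun_eq_iff)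
    have "T (deriv (deriv H) z) + T (- deriv (deriv H) z) = 0"
      using linear_neg[OF bounded_linear.linear[OF T]] by simp
    then show "blinfun_apply (blinfun_apply (P o\<^sub>L blinfun_mult_right (deriv (deriv H) z)) 1) 1 +
        blinfun_apply (blinfun_apply (P o\<^sub>L blinfun_mult_right (deriv (deriv H) z)) \<i>) \<i> = 0"
      by (simp add: P B mult.assoc)
  next
    show "continuous_on S (\<lambda>z. P o\<^sub>L blinfun_mult_right (deriv (deriv H) z))"
      by (intro bounded_linear.continuous_on[OF bounded_bilinear.bounded_linear_right[OF bounded_bilinear_blinfun_compose]]
          bounded_linear.continuous_on[OF bounded_linear_blinfun_mult_right] holomorphic_on_imp_continuous_on[OF H''])
  qed (rule S)
qed

lemma linear_holomorphic_has_derivative: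
  fixes T :: "complex \<Rightarrow> complex"
  assumes "bounded_linear T" "(H has_field_derivative a) (at 0)"
  shows "((\<lambda>z. T (H z)) has_derivative (\<lambda>h. T (a * h))) (at 0)"
  using bounded_linear.has_derivative[OF assms(1)] assms(2) unfolding has_field_derivative_def by blast

text \<open>\<open>Arctan\<close> maps the disk into the strip of real parts below pi/4 in modulus,
  so rescaling its real part by 4/pi fills the interval (-1,1).\<close>

lemma extremal_at_zero:
  obtains f where "f \<in> harmonic_disk_maps 0" "norm (diff0 f 1) = 4 / pi"
proof
  define T :: "complex \<Rightarrow> complex" where "T = (\<lambda>h. of_real (4 / pi * Re h))"
  have T: "bounded_linear T"
    unfolding T_def
    by (intro bounded_linear_compose[OF bounded_linear_of_real] bounded_linear_compose[OF bounded_linear_mult_right] bounded_linear_Re)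
  define f where "f = (\<lambda>z. T (Arctan z))"
  have im: "\<bar>Im z\<bar> < 1" if "z \<in> unit_disk" for z
    using abs_Im_le_cmod[of z] that by simp
  have "harmonic_on f unit_disk"
    unfolding f_def by (rule harmonic_on_linear_holomorphic[OF T]) (auto intro!: holomorphic_on_Arctan im)
  moreover have "f z \<in> unit_disk" if z: "z \<in> unit_disk" for z
  proof -
    have z1: "norm z < 1" using z by simp
    have ne: "1 + \<i> * z \<noteq> 0"
    proof
      assume "1 + \<i> * z = 0"
      then have "\<i> * z = -1" by (simp add: eq_neg_iff_add_eq_0 add.commute)
      then have "norm (\<i> * z) = 1" by simp
      then show False using z1 by (simp add: norm_mult)
    qed
    \<comment> \<open>The Moebius quotient inside the logarithm of \<open>Arctan\<close> lies in the
      right half-plane, which bounds the imaginary part of that logarithm by pi/2.\<close>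
    have "Re ((1 - \<i> * z) * cnj (1 + \<i> * z)) = 1 - (norm z)\<^sup>2"
      by (simp add: cmod_power2) (simp add: algebra_simps power2_eq_square)
    also have "\<dots> > 0" using z1 by (simp add: abs_square_less_1)
    finally have "0 < Re ((1 - \<i> * z) / (1 + \<i> * z))"
      using ne by (subst complex_div_cnj) (simp add: Re_divide_of_real divide_pos_pos flip: of_real_power)
    then have "\<bar>Im (Ln ((1 - \<i> * z) / (1 + \<i> * z)))\<bar> < pi / 2"
      by (rule Re_Ln_pos_lt_imp)
    then have "\<bar>4 / pi * Re (Arctan z)\<bar> < 1"
      by (simp add: Arctan_def abs_mult field_simps)
    then show ?thesis by (simp only: f_def T_def mem_ball_0 norm_of_real)
  qed
  moreover have "f 0 = 0" by (simp add: f_def T_def)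
  ultimately show "f \<in> harmonic_disk_maps 0" by (simp add: harmonic_disk_maps_def)
  have "(Arctan has_field_derivative inverse (1 + 0\<^sup>2)) (at 0)"
    by (rule has_field_derivative_Arctan) simp
  then have "(f has_derivative (\<lambda>h. T (inverse (1 + 0\<^sup>2) * h))) (at 0)"
    unfolding f_def by (rule linear_holomorphic_has_derivative[OF T])
  then have "diff0 f 1 = T 1"
    unfolding diff0_def by (subst frechet_derivative_at[symmetric]) auto
  then show "norm (diff0 f 1) = 4 / pi" by (simp add: T_def norm_divide)
qed

section \<open>Herglotz and Poisson integrals of boundary data on the unit circle\<close>

definition herglotz :: "(real \<Rightarrow> real) \<Rightarrow> complex \<Rightarrow> complex" where
  "herglotz \<phi> z = integral {0..2*pi} (\<lambda>t. (cis t + z) / (cis t - z) * \<phi> t)"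

lemma cis_minus_nonzero: "z \<in> unit_disk \<Longrightarrow> cis t - z \<noteq> 0"
  by (metis dist_0_norm eq_iff_diff_eq_0 less_irrefl mem_ball norm_cis)

lemma herglotz_has_integral:
  assumes "continuous_on {0..2*pi} \<phi>" "z \<in> unit_disk"
  shows "((\<lambda>t. (cis t + z) / (cis t - z) * \<phi> t) has_integral herglotz \<phi> z) {0..2*pi}"
  unfolding herglotz_def
  by (intro integrable_integral integrable_continuous_interval continuous_intros assms)
    (use cis_minus_nonzero[OF assms(2)] in auto)

text \<open>Differentiation under the integral sign. At \<open>z = 0\<close> the kernel becomes
  \<open>2 * cis (- t)\<close>, whose real part is the weight \<open>2 * cos t\<close> of the
  derivative formula.\<close>

lemma herglotz_has_field_derivative:
  assumes \<phi>: "continuous_on {0..2*pi} \<phi>" and z: "z \<in> unit_disk"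
  shows "(herglotz \<phi> has_field_derivative integral {0..2*pi} (\<lambda>t. 2 * cis t / (cis t - z)\<^sup>2 * \<phi> t)) (at z)"
proof -
  have "((\<lambda>z. integral (cbox 0 (2*pi)) (\<lambda>t. (cis t + z) / (cis t - z) * \<phi> t)) has_field_derivative
      integral (cbox 0 (2*pi)) (\<lambda>t. 2 * cis t / (cis t - z)\<^sup>2 * \<phi> t)) (at z within unit_disk)"
  proof (rule leibniz_rule_field_derivative[OF _ _ _ z convex_ball])
    fix x :: complex and t :: real assume x: "x \<in> unit_disk"
    show "((\<lambda>x. (cis t + x) / (cis t - x) * \<phi> t) has_field_derivative 2 * cis t / (cis t - x)\<^sup>2 * \<phi> t) (at x within unit_disk)"
      using cis_minus_nonzero[OF x, of t]
      by (auto intro!: derivative_eq_intros simp: power2_eq_square field_simps)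
  next
    fix x :: complex assume "x \<in> unit_disk"
    then show "(\<lambda>t. (cis t + x) / (cis t - x) * \<phi> t) integrable_on cbox 0 (2 * pi)"
      using herglotz_has_integral[OF \<phi>] by (auto simp: has_integral_integrable)
  next
    have "continuous_on (unit_disk \<times> {0..2*pi}) (\<lambda>p. 2 * cis (snd p) / (cis (snd p) - fst p)\<^sup>2 * \<phi> (snd p))"
      by (intro continuous_intros continuous_on_compose2[OF \<phi>]) (use cis_minus_nonzero in auto)
    then show "continuous_on (unit_disk \<times> cbox 0 (2 * pi)) (\<lambda>(x, t). 2 * cis t / (cis t - x)\<^sup>2 * \<phi> t)"
      by (simp add: split_beta)
  qed
  then show ?thesis
    unfolding at_within_open[OF z open_ball] herglotz_def[abs_def] by simp
qed

lemma herglotz_holomorphic: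
  "continuous_on {0..2*pi} \<phi> \<Longrightarrow> herglotz \<phi> holomorphic_on unit_disk"
  unfolding holomorphic_on_open[OF open_ball] using herglotz_has_field_derivative by blast

definition poisson_kernel :: "complex \<Rightarrow> real \<Rightarrow> real" where
  "poisson_kernel z t = Re ((cis t + z) / (cis t - z))"

text \<open>The kernel equals (1 - |z|^2) / |cis t - z|^2, seen by multiplying through with the
  conjugate denominator.\<close>

lemma poisson_kernel_pos:
  assumes "z \<in> unit_disk"
  shows "0 < poisson_kernel z t"
proof -
  have ne: "cis t - z \<noteq> 0" by (rule cis_minus_nonzero[OF assms])
  have "Re ((cis t + z) * cnj (cis t - z)) = ((cos t)\<^sup>2 + (sin t)\<^sup>2) - (norm z)\<^sup>2"
    unfolding cmod_power2 by (simp add: algebra_simps power2_eq_square)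
  also have "\<dots> > 0" using assms by (simp add: abs_square_less_1)
  finally show ?thesis
    unfolding poisson_kernel_def
    using ne by (subst complex_div_cnj) (simp add: Re_divide_of_real divide_pos_pos flip: of_real_power)
qed

lemma continuous_on_poisson_kernel:
  "z \<in> unit_disk \<Longrightarrow> continuous_on A (poisson_kernel z)"
  unfolding poisson_kernel_def[abs_def]
  by (intro continuous_intros) (use cis_minus_nonzero in auto)

lemma poisson_has_integral:
  assumes "continuous_on {0..2*pi} \<phi>" "z \<in> unit_disk"
  shows "((\<lambda>t. poisson_kernel z t * \<phi> t) has_integral Re (herglotz \<phi> z)) {0..2*pi}"
proof -
  have "Re (a * of_real x) = Re a * x" for a x by simp
  then show ?thesis
    using has_integral_Re[OF herglotz_has_integral[OF assms]] by (simp only: poisson_kernel_def)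
qed

text \<open>With c for \<open>cis t\<close>, the kernel is 2c/(c - z) - 1, and both terms are Cauchy
  integrals of constants. The real part gives the Poisson kernel total mass 2 pi.\<close>

lemma herglotz_one:
  assumes z: "z \<in> unit_disk"
  shows "herglotz (\<lambda>_. 1) z = 2 * pi"
proof -
  have "((\<lambda>u. 1 / (u - z)) has_contour_integral 2 * of_real pi * \<i> * 1) (circlepath 0 1)"
    by (rule Cauchy_integral_circlepath) (use z in auto)
  note 1 = has_contour_integral_circlepath_cis[OF this]
  have "((\<lambda>u. 1 / (u - 0)) has_contour_integral 2 * of_real pi * \<i> * 1) (circlepath 0 1)"
    by (rule Cauchy_integral_circlepath) auto
  note 2 = has_contour_integral_circlepath_cis[OF this]
  have "((\<lambda>t. (cis t + z) / (cis t - z) * of_real 1) has_integral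
      - 2 * \<i> * (2 * of_real pi * \<i> * 1) - - \<i> * (2 * of_real pi * \<i> * 1)) {0..2*pi}"
    by (rule has_integral_eq[OF _ has_integral_diff[OF has_integral_mult_right[OF 1, of "- 2 * \<i>"]
          has_integral_mult_right[OF 2, of "- \<i>"]]])
       (use cis_minus_nonzero[OF z] in \<open>simp add: field_simps\<close>)
  from has_integral_unique[OF herglotz_has_integral[OF _ z, of "\<lambda>_. 1"] this] show ?thesis
    by simp
qed

text \<open>\<open>\<phi>\<close> and \<open>\<psi>\<close> are the coordinates of the boundary
  values in the frame \<open>e\<close>, \<open>e * \<i>\<close>. The value at 0 is \<open>w\<close>
  by the equation for \<open>lambda\<close> and the vanishing mean of \<open>\<psi>\<close>; the
  derivative of the \<open>\<psi>\<close> part produces \<open>calM\<close>.\<close>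

lemma extremal_at_nonzero:
  assumes w: "0 < norm w" "norm w < 1"
  obtains f where "f \<in> harmonic_disk_maps w" "norm (diff0 f 1) = calM (norm w)"
proof -
  define l where "l = lambda (norm w)"
  have l: "0 < l" using lambda_props(1)[OF w] by (simp add: l_def)
  define s where "s = (\<lambda>t. sqrt (l\<^sup>2 + (cos t)\<^sup>2))"
  define \<phi> where "\<phi> = (\<lambda>t. l / s t)"
  define \<psi> where "\<psi> = (\<lambda>t. cos t / s t)"
  have s: "0 < s t" "(s t)\<^sup>2 = l\<^sup>2 + (cos t)\<^sup>2" for t
    using sq_add_cos_pos[OF l, of t] by (auto simp: s_def)
  have cs: "continuous_on A s" for A unfolding s_def by (intro continuous_intros)
  have c: "continuous_on A \<phi>" "continuous_on A \<psi>" for A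
    unfolding \<phi>_def \<psi>_def using s(1) by (intro continuous_intros cs; metis less_irrefl)+
  have norm1: "(\<phi> t)\<^sup>2 + (\<psi> t)\<^sup>2 = 1" for t
    using s(1)[of t] unfolding \<phi>_def \<psi>_def power_divide add_divide_distrib[symmetric] by (simp flip: s(2))
  obtain e where e: "norm e = 1" "w = norm w *\<^sub>R e" by (rule unit_vector_of)
  \<comment> \<open>Taking real parts makes the Herglotz integrals Poisson integrals, and
    \<open>1 / (2 * pi)\<close> supplies the normalisation that \<open>herglotz\<close>
    omits.\<close>
  define T1 where "T1 = (\<lambda>h. e / (2 * pi) * of_real (Re h))"
  define T2 where "T2 = (\<lambda>h. e * \<i> / (2 * pi) * of_real (Re h))"
  have T: "bounded_linear T1" "bounded_linear T2"
    unfolding T1_def T2_def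
    by (intro bounded_linear_compose[OF bounded_linear_mult_right]
        bounded_linear_compose[OF bounded_linear_of_real] bounded_linear_Re)+
  define f where "f = (\<lambda>z. T1 (herglotz \<phi> z) + T2 (herglotz \<psi> z))"
  have "harmonic_on f unit_disk"
    unfolding f_def
    by (intro harmonic_on_add harmonic_on_linear_holomorphic T herglotz_holomorphic c open_ball)
  moreover have "f z \<in> unit_disk" if z: "z \<in> unit_disk" for z
  proof (rule ccontr)
    assume "f z \<notin> unit_disk"
    define a where "a = Re (herglotz \<phi> z) / (2 * pi)"
    define b where "b = Re (herglotz \<psi> z) / (2 * pi)"
    have "f z = e * Complex a b"
      by (simp add: f_def T1_def T2_def a_def b_def Complex_eq algebra_simps)
    then have "1 \<le> norm (Complex a b)"
      using \<open>f z \<notin> unit_disk\<close> e(1) by (simp add: norm_mult)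
    define N where "N = norm (Complex a b)"
    have N: "1 \<le> N" "N\<^sup>2 = a\<^sup>2 + b\<^sup>2"
      using \<open>1 \<le> norm (Complex a b)\<close> by (simp_all add: N_def cmod_power2)
    \<comment> \<open>If the average of unit vectors had norm \<open>N\<close> at least 1,
      projecting on its direction would give this nonnegative integrand the integral
      \<open>2 * pi * (1 - N)\<close>, at most 0. So it vanishes and the boundary values are
      constant.\<close>
    let ?g = "\<lambda>t. poisson_kernel z t * (1 - (a / N * \<phi> t + b / N * \<psi> t))"
    have ab: "(a / N)\<^sup>2 + (b / N)\<^sup>2 = 1"
      using N(1) unfolding power_divide add_divide_distrib[symmetric] N(2)[symmetric] by simp
    have nonneg: "0 \<le> ?g t" for t
    proof -
      have "0 \<le> (a / N - \<phi> t)\<^sup>2 + (b / N - \<psi> t)\<^sup>2" by simp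
      also have "\<dots> = ((a / N)\<^sup>2 + (b / N)\<^sup>2) + ((\<phi> t)\<^sup>2 + (\<psi> t)\<^sup>2) - 2 * (a / N * \<phi> t + b / N * \<psi> t)"
        unfolding power2_diff by (simp add: algebra_simps)
      also have "\<dots> = 2 * (1 - (a / N * \<phi> t + b / N * \<psi> t))"
        unfolding ab norm1 by simp
      finally show ?thesis using poisson_kernel_pos[OF z, of t] by simp
    qed
    have cont: "continuous_on {0..2*pi} ?g"
      by (intro continuous_intros continuous_on_poisson_kernel z c)
    have "(?g has_integral 2 * pi - (a / N * (2 * pi * a) + b / N * (2 * pi * b))) {0..2*pi}"
    proof (rule has_integral_eq)
      show "((\<lambda>t. poisson_kernel z t * 1 - (a / N * (poisson_kernel z t * \<phi> t) + b / N * (poisson_kernel z t * \<psi> t)))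
          has_integral 2 * pi - (a / N * (2 * pi * a) + b / N * (2 * pi * b))) {0..2*pi}"
        using poisson_has_integral[OF c(1) z] poisson_has_integral[OF c(2) z]
          poisson_has_integral[OF continuous_on_const z, of 1] herglotz_one[OF z]
        by (intro has_integral_diff has_integral_add has_integral_mult_right) (simp_all add: a_def b_def)
    qed (simp add: algebra_simps)
    moreover have "a / N * (2 * pi * a) + b / N * (2 * pi * b) = 2 * pi * N"
    proof -
      have "a / N * (2 * pi * a) + b / N * (2 * pi * b) = 2 * pi * (N\<^sup>2) / N"
        unfolding N(2) by (simp add: power2_eq_square algebra_simps add_divide_distrib)
      then show ?thesis using N(1) by (simp add: power2_eq_square)
    qed
    ultimately have "integral {0..2*pi} ?g = 2 * pi - 2 * pi * N" by (simp add: integral_unique)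
    also have "\<dots> \<le> 0" using N by simp
    finally have "integral {0..2*pi} ?g \<le> 0" .
    moreover have "0 \<le> integral {0..2*pi} ?g"
      by (rule integral_nonneg[OF integrable_continuous_interval[OF cont]]) (rule nonneg)
    ultimately have "integral {0..2*pi} ?g = 0" by (rule antisym)
    then have zero: "\<forall>t\<in>{0..2*pi}. ?g t = 0"
      by (subst (asm) integral_eq_0_iff[OF cont]) (use nonneg in auto)
    have at: "a / N * \<phi> t + b / N * \<psi> t = 1" if "t \<in> {0..2*pi}" for t
      using bspec[OF zero that] poisson_kernel_pos[OF z, of t] by simp
    have at_s: "a / N * l + b / N * cos t = s t" if "t \<in> {0..2*pi}" for t
    proof -
      have "\<phi> t * s t = l" "\<psi> t * s t = cos t" using s(1)[of t] by (simp_all add: \<phi>_def \<psi>_def)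
      then have "a / N * l + b / N * cos t = (a / N * \<phi> t + b / N * \<psi> t) * s t"
        by (simp only: distrib_right mult.assoc)
      then show ?thesis unfolding at[OF that] by simp
    qed
    \<comment> \<open>The cosine changes sign between 0 and \<open>pi\<close> while \<open>s\<close>
      does not, which kills \<open>b\<close>; then \<open>(s 0)\<^sup>2\<close> would be
      \<open>l\<^sup>2\<close> instead of \<open>l\<^sup>2 + 1\<close>.\<close>
    have "a / N * l + b / N = s 0" "a / N * l - b / N = s pi" "s pi = s 0"
      using at_s[of 0] at_s[of pi] by (simp_all add: s_def)
    then have "b / N = 0" "a / N * l = s 0" by linarith+
    with ab have "(a / N)\<^sup>2 = 1" by (simp del: power_divide)
    then have "(s 0)\<^sup>2 = l\<^sup>2"
      using \<open>a / N * l = s 0\<close> by (metis mult_1 power_mult_distrib)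
    then show False using s(2)[of 0] by simp
  qed
  moreover have "Re (herglotz \<phi> 0) = 2 * pi * norm w"
    using has_integral_unique[OF poisson_has_integral[OF c(1), of 0]] lambda_has_integral[OF w]
    by (simp add: poisson_kernel_def \<phi>_def s_def l_def)
  moreover have "Re (herglotz \<psi> 0) = 0"
    using has_integral_unique[OF poisson_has_integral[OF c(2), of 0]] integral_cos_div_sqrt[OF l]
    by (simp add: poisson_kernel_def \<psi>_def s_def)
  ultimately have "f \<in> harmonic_disk_maps w"
    using e(2) by (simp add: harmonic_disk_maps_def f_def T1_def T2_def scaleR_conv_of_real mult.commute)
  define d where "d = (\<lambda>\<eta>::real \<Rightarrow> real. integral {0..2*pi} (\<lambda>t. 2 * cis t / (cis t - 0)\<^sup>2 * \<eta> t))"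
  have der: "(herglotz \<eta> has_field_derivative d \<eta>) (at 0)" if "continuous_on {0..2*pi} \<eta>" for \<eta>
    unfolding d_def by (rule herglotz_has_field_derivative[OF that]) simp
  have "(f has_derivative (\<lambda>h. T1 (d \<phi> * h) + T2 (d \<psi> * h))) (at 0)"
    unfolding f_def by (intro has_derivative_add linear_holomorphic_has_derivative T der c)
  from frechet_derivative_at[OF this] have "diff0 f = (\<lambda>h. T1 (d \<phi> * h) + T2 (d \<psi> * h))"
    by (simp only: diff0_def)
  then have "diff0 f 1 = T1 (d \<phi> * 1) + T2 (d \<psi> * 1)" by simp
  also have "\<dots> = e * Complex (Re (d \<phi>) / (2 * pi)) (Re (d \<psi>) / (2 * pi))"
    by (simp add: T1_def T2_def Complex_eq algebra_simps)
  finally have n: "norm (diff0 f 1) = norm (Complex (Re (d \<phi>) / (2 * pi)) (Re (d \<psi>) / (2 * pi)))"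
    using e(1) by (simp add: norm_mult)
  \<comment> \<open>The component along \<open>e * \<i>\<close> gives the lower bound; the general
    upper bound closes the gap.\<close>
  have "\<bar>Re (d \<psi>) / (2 * pi)\<bar> \<le> norm (diff0 f 1)"
    unfolding n using abs_Im_le_cmod[of "Complex (Re (d \<phi>) / (2 * pi)) (Re (d \<psi>) / (2 * pi))"]
    by (simp only: complex.sel)
  moreover have "Re (d \<psi>) = 2 * pi * calM (norm w)"
  proof -
    have "((\<lambda>t. 2 * cis t / (cis t - 0)\<^sup>2 * \<psi> t) has_integral d \<psi>) {0..2*pi}"
      unfolding d_def by (intro integrable_integral integrable_continuous_interval continuous_intros c) simp
    note 1 = has_integral_Re[OF this]
    have "((\<lambda>t. Re (2 * cis t / (cis t - 0)\<^sup>2 * \<psi> t)) has_integral 2 * (pi * calM (norm w))) {0..2*pi}"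
    proof (rule has_integral_eq[OF _ has_integral_mult_right[OF calM_has_integral[OF w]]])
      fix t
      have "2 * cis t / (cis t - 0)\<^sup>2 = 2 * cis (- t)"
        by (simp add: power2_eq_square field_simps flip: cis_inverse)
      then have "Re (2 * cis t / (cis t - 0)\<^sup>2 * \<psi> t) = 2 * cos t * \<psi> t" by simp
      then show "2 * ((cos t)\<^sup>2 / sqrt ((lambda (norm w))\<^sup>2 + (cos t)\<^sup>2)) = Re (2 * cis t / (cis t - 0)\<^sup>2 * \<psi> t)"
        by (simp add: \<psi>_def s_def l_def power2_eq_square)
    qed
    from has_integral_unique[OF 1 this] show ?thesis by simp
  qed
  ultimately have "calM (norm w) \<le> norm (diff0 f 1)"
    using calM_nonneg[of "norm w"] by simp
  moreover have "norm (diff0 f 1) \<le> calM (norm w)"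
    by (rule harmonic_disk_derivative_le_calM[OF \<open>f \<in> harmonic_disk_maps w\<close> _ w(2)]) simp
  ultimately show ?thesis using that \<open>f \<in> harmonic_disk_maps w\<close> by (simp add: antisym)
qed

subsection \<open>The polydisk\<close>

lemma extremal_exists:
  assumes "norm w < 1"
  obtains f where "f \<in> harmonic_disk_maps w" "norm (diff0 f 1) = calM (norm w)"
proof (cases "w = 0")
  case True
  then show ?thesis using extremal_at_zero that by (auto simp: calM_def)
next
  case False
  then show ?thesis using extremal_at_nonzero[of w] assms that by auto
qed

lemma harmonic_disk_maps_has_derivative:
  assumes "f \<in> harmonic_disk_maps w"
  shows "(f has_derivative diff0 f) (at 0)"
proof -
  have "harmonic_on f unit_disk" using assms by (simp add: harmonic_disk_maps_def)
  then have "f differentiable (at 0)" by (rule harmonic_differentiable_at) simp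
  then show ?thesis by (rule diff0_has_derivative)
qed

section \<open>Operator norms of real-linear maps on the plane\<close>

lemma norm_le_of_unit_bound:
  fixes L :: "complex \<Rightarrow> 'b::real_normed_vector"
  assumes L: "bounded_linear L" and b: "\<And>v. norm v = 1 \<Longrightarrow> norm (L v) \<le> b"
  shows "norm (L v) \<le> b * norm v"
proof (cases "v = 0")
  case True
  then show ?thesis using linear_0[OF bounded_linear.linear[OF L]] by simp
next
  case False
  have "L v = norm v *\<^sub>R L (sgn v)"
    using False linear_scale[OF bounded_linear.linear[OF L], of "norm v" "sgn v"] by (simp add: sgn_div_norm)
  then show ?thesis
    using False mult_left_mono[OF b[of "sgn v"] norm_ge_zero[of v]] by (simp add: norm_sgn mult.commute)
qed

text \<open>Compactness of the unit circle. The maximising vector is what becomes the common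
  direction in the equality case.\<close>

lemma onorm_attained:
  fixes L :: "complex \<Rightarrow> 'b::real_normed_vector"
  assumes L: "bounded_linear L"
  obtains v where "norm v = 1" "norm (L v) = onorm L"
proof -
  have "continuous_on (sphere 0 1) (\<lambda>v. norm (L v))"
    by (intro continuous_on_norm linear_continuous_on L)
  then obtain v where v: "v \<in> sphere 0 1" "\<And>x. x \<in> sphere 0 1 \<Longrightarrow> norm (L x) \<le> norm (L v)"
    using continuous_attains_sup[of "sphere (0::complex) 1" "\<lambda>v. norm (L v)"] by auto
  have "onorm L \<le> norm (L v)"
    by (rule onorm_bound) (use v norm_le_of_unit_bound[OF L] in auto)
  moreover have "norm (L v) \<le> onorm L"
    using onorm[OF L, of v] v(1) by simp
  ultimately show ?thesis using that v(1) by simp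
qed

lemma onorm_diff0_le_calM:
  assumes "f \<in> harmonic_disk_maps w" "norm w < 1"
  shows "onorm (diff0 f) \<le> calM (norm w)"
proof (rule onorm_bound[OF calM_nonneg])
  show "norm (diff0 f v) \<le> calM (norm w) * norm v" for v
    using has_derivative_bounded_linear[OF harmonic_disk_maps_has_derivative[OF assms(1)]]
    by (rule norm_le_of_unit_bound) (rule harmonic_disk_derivative_le_calM[OF assms(1) _ assms(2)])
qed

text \<open>The supremum is a maximum, realised by the explicit extremal map; extremality thereby
  becomes the equation \<open>onorm (diff0 f) = calM (norm w)\<close>.\<close>

lemma SUP_onorm_disk:
  assumes "norm w < 1"
  shows "(SUP g\<in>harmonic_disk_maps w. onorm (diff0 g)) = calM (norm w)"
proof -
  obtain f where f: "f \<in> harmonic_disk_maps w" "norm (diff0 f 1) = calM (norm w)"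
    using extremal_exists[OF assms] .
  have "calM (norm w) \<le> onorm (diff0 f)"
    using onorm[OF has_derivative_bounded_linear[OF harmonic_disk_maps_has_derivative[OF f(1)]], of 1] f(2) by simp
  then have "onorm (diff0 f) = calM (norm w)"
    using onorm_diff0_le_calM[OF f(1) assms] by simp
  then show ?thesis
    by (intro cSup_eq_maximum) (use f(1) onorm_diff0_le_calM[OF _ assms] in \<open>auto simp: image_iff intro: bexI[of _ f]\<close>)
qed

lemma polydisk_component:
  "F \<in> harmonic_polydisk_maps p \<Longrightarrow> (\<lambda>z. F z $ j) \<in> harmonic_disk_maps (p $ j)"
  by (auto simp: harmonic_polydisk_maps_def harmonic_disk_maps_def unit_polydisk_def)

text \<open>The standard basis of the target consists of the vectors \<open>axis j b\<close> with
  \<open>b\<close> in the basis of the plane, so real coordinates of \<open>F\<close> are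
  coordinates of its components.\<close>

lemma polydisk_has_derivative:
  assumes "F \<in> harmonic_polydisk_maps p"
  shows "(F has_derivative (\<lambda>h. \<chi> j. diff0 (\<lambda>z. F z $ j) h)) (at 0)"
proof -
  have "((\<lambda>z. F z $ j \<bullet> b) has_derivative (\<lambda>h. diff0 (\<lambda>z. F z $ j) h \<bullet> b)) (at 0)" for j b
    by (intro has_derivative_inner_left harmonic_disk_maps_has_derivative[OF polydisk_component[OF assms]])
  then show ?thesis
    by (subst has_derivative_componentwise_within) (auto simp: Basis_vec_def inner_axis)
qed

lemma norm_diff0_polydisk:
  assumes "F \<in> harmonic_polydisk_maps p"
  shows "norm (diff0 F v) = sqrt (\<Sum>j\<in>UNIV. (norm (diff0 (\<lambda>z. F z $ j) v))\<^sup>2)"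
proof -
  have "diff0 F = (\<lambda>h. \<chi> j. diff0 (\<lambda>z. F z $ j) h)"
    unfolding diff0_def[of F] by (rule frechet_derivative_at[symmetric, OF polydisk_has_derivative[OF assms]])
  then show ?thesis by (simp add: norm_vec_def L2_set_def)
qed

theorem theorem11p1:
  fixes p :: "complex ^ 'n::finite"
  assumes "p \<in> unit_polydisk"
  shows "(\<forall>F \<in> harmonic_polydisk_maps p. onorm (diff0 F) \<le> M_polydisk p) \<and>
         (SUP F \<in> harmonic_polydisk_maps p. onorm (diff0 F)) = M_polydisk p \<and>
         (\<forall>F \<in> harmonic_polydisk_maps p.
            onorm (diff0 F) = M_polydisk p \<longleftrightarrow>
            (\<forall>j. extremal_at (p $ j) (\<lambda>z. F z $ j)) \<and>
            (\<exists>v::complex. norm v = 1 \<and>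
               (\<forall>j. norm (diff0 (\<lambda>z. F z $ j) v) = onorm (diff0 (\<lambda>z. F z $ j)))))"
proof -
  have p: "norm (p $ j) < 1" for j
    using assms by (simp add: unit_polydisk_def)
  have comp_le: "norm (diff0 (\<lambda>z. F z $ j) v) \<le> calM (norm (p $ j))"
    if "F \<in> harmonic_polydisk_maps p" "norm v = 1" for F v j
    using harmonic_disk_derivative_le_calM[OF polydisk_component[OF that(1)] that(2) p] .
  have lin: "bounded_linear (diff0 F)" if "F \<in> harmonic_polydisk_maps p" for F
  proof (rule has_derivative_bounded_linear)
    show "(F has_derivative diff0 F) (at 0)"
      using polydisk_has_derivative[OF that] by (intro diff0_has_derivative) (auto simp: differentiable_def)
  qed
  have clin: "bounded_linear (diff0 (\<lambda>z. F z $ j))" if "F \<in> harmonic_polydisk_maps p" for F j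
    using has_derivative_bounded_linear[OF harmonic_disk_maps_has_derivative[OF polydisk_component[OF that]]] .
  have upper: "onorm (diff0 F) \<le> M_polydisk p" if F: "F \<in> harmonic_polydisk_maps p" for F
  proof -
    obtain v where v: "norm v = 1" "norm (diff0 F v) = onorm (diff0 F)"
      using onorm_attained[OF lin[OF F]] .
    have "norm (diff0 F v) \<le> M_polydisk p"
      unfolding norm_diff0_polydisk[OF F] M_polydisk_def
      by (intro real_sqrt_le_mono sum_mono power_mono comp_le F v norm_ge_zero)
    then show ?thesis using v by simp
  qed
  \<comment> \<open>Saturation of all components at one \<open>v\<close> makes the norm there equal
    to the upper bound for the operator norm; this serves both sharpness and the converse of the
    equality clause.\<close>
  have attain: "onorm (diff0 F) = M_polydisk p"
    if F: "F \<in> harmonic_polydisk_maps p" and v: "norm v = 1"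
      and "\<And>j. norm (diff0 (\<lambda>z. F z $ j) v) = calM (norm (p $ j))" for F v
  proof -
    have "norm (diff0 F v) = M_polydisk p"
      unfolding norm_diff0_polydisk[OF F] M_polydisk_def that(3) ..
    then show ?thesis using onorm[OF lin[OF F], of v] upper[OF F] v by simp
  qed
  have ext: "extremal_at (p $ j) (\<lambda>z. F z $ j) \<longleftrightarrow> onorm (diff0 (\<lambda>z. F z $ j)) = calM (norm (p $ j))"
    if "F \<in> harmonic_polydisk_maps p" for F j
    using polydisk_component[OF that] by (simp add: extremal_at_def SUP_onorm_disk[OF p])
  have "(SUP F \<in> harmonic_polydisk_maps p. onorm (diff0 F)) = M_polydisk p"
  proof -
    have "\<exists>f. f \<in> harmonic_disk_maps (p $ j) \<and> norm (diff0 f 1) = calM (norm (p $ j))" for j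
      using extremal_exists[OF p] by blast
    then obtain f where f: "\<And>j. f j \<in> harmonic_disk_maps (p $ j)"
        "\<And>j. norm (diff0 (f j) 1) = calM (norm (p $ j))"
      by metis
    define F where "F = (\<lambda>z. \<chi> j. f j z)"
    have F: "F \<in> harmonic_polydisk_maps p"
      using f(1) by (auto simp: F_def harmonic_polydisk_maps_def harmonic_disk_maps_def unit_polydisk_def vec_eq_iff)
    have "onorm (diff0 F) = M_polydisk p"
      by (rule attain[OF F, of 1]) (simp_all add: F_def f(2))
    then show ?thesis
      by (intro cSup_eq_maximum) (use F upper in \<open>auto simp: image_iff intro: bexI[of _ F]\<close>)
  qed
  moreover have "onorm (diff0 F) = M_polydisk p \<longleftrightarrow>
      (\<forall>j. extremal_at (p $ j) (\<lambda>z. F z $ j)) \<and>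
      (\<exists>v::complex. norm v = 1 \<and> (\<forall>j. norm (diff0 (\<lambda>z. F z $ j) v) = onorm (diff0 (\<lambda>z. F z $ j))))"
    if F: "F \<in> harmonic_polydisk_maps p" for F
  proof
    assume eq: "onorm (diff0 F) = M_polydisk p"
    obtain v where v: "norm v = 1" "norm (diff0 F v) = onorm (diff0 F)"
      using onorm_attained[OF lin[OF F]] .
    have le: "(norm (diff0 (\<lambda>z. F z $ j) v))\<^sup>2 \<le> (calM (norm (p $ j)))\<^sup>2" for j
      by (intro power_mono comp_le F v norm_ge_zero)
    have "(\<Sum>j\<in>UNIV. (norm (diff0 (\<lambda>z. F z $ j) v))\<^sup>2) = (\<Sum>j\<in>UNIV. (calM (norm (p $ j)))\<^sup>2)"
      using eq v(2) unfolding norm_diff0_polydisk[OF F] M_polydisk_def by simp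
    \<comment> \<open>Termwise inequalities between finite sums with equal totals are
      equalities.\<close>
    then have "(norm (diff0 (\<lambda>z. F z $ j) v))\<^sup>2 = (calM (norm (p $ j)))\<^sup>2" for j
      using sum_mono_inv[of "\<lambda>j. (norm (diff0 (\<lambda>z. F z $ j) v))\<^sup>2" UNIV "\<lambda>j. (calM (norm (p $ j)))\<^sup>2" j] le
      by simp
    then have n: "norm (diff0 (\<lambda>z. F z $ j) v) = calM (norm (p $ j))" for j
      using calM_nonneg by (simp add: power2_eq_iff_nonneg)
    \<comment> \<open>Squeeze: the value at \<open>v\<close> is at most the operator norm, which is
      at most \<open>calM\<close>, and the value at \<open>v\<close> is already
      \<open>calM\<close>.\<close>
    have o: "onorm (diff0 (\<lambda>z. F z $ j)) = calM (norm (p $ j))" for j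
      using onorm[OF clin[OF F], of j v] n[of j] v(1) onorm_diff0_le_calM[OF polydisk_component[OF F] p, of j]
      by simp
    show "(\<forall>j. extremal_at (p $ j) (\<lambda>z. F z $ j)) \<and>
      (\<exists>v::complex. norm v = 1 \<and> (\<forall>j. norm (diff0 (\<lambda>z. F z $ j) v) = onorm (diff0 (\<lambda>z. F z $ j))))"
      using ext[OF F] o n v(1) by auto
  next
    assume "(\<forall>j. extremal_at (p $ j) (\<lambda>z. F z $ j)) \<and>
      (\<exists>v::complex. norm v = 1 \<and> (\<forall>j. norm (diff0 (\<lambda>z. F z $ j) v) = onorm (diff0 (\<lambda>z. F z $ j))))"
    then show "onorm (diff0 F) = M_polydisk p"
      using ext[OF F] attain[OF F] by auto
  qed
  ultimately show ?thesis using upper by blast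
qed

end
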